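(* Fix a field $K$. The following two statements are equivalent. (Simon conjecture) For all integers $1\le d\le n$, with $S=K[x_1,\dots,x_n]$: if $I\subset S$ is a squarefree monomial ideal with linear quotients such that $G(I)\subseteq G(I_{n,d})$, then $I$ can be extended to $I_{n,d}$ by linear quotients. (Monomial Simon conjecture) For all integers $n,d\ge1$, with $S=K[x_1,\dots,x_n]$ and $\mathfrak m=(x_1,\dots,x_n)$: if $I\subset S$ is a monomial ideal with linear quotients such that $G(I)\subseteq G(\mathfrak m^d)$, then $I$ can be extended to $\mathfrak m^d$ by linear quotients.
   Context: For a monomial ideal $I\subset S=K[x_1,\dots,x_n]$, $G(I)$ denotes its minimal monomial generating set. $I$ has linear quotients if there is an order $u_1,\dots,u_m$ of $G(I)$ such that $(u_1,\dots,u_{j-1}):u_j$ is generated by variables (i.e. by a subset of $\{x_1,\dots,x_n\}$) for $j=2,\dots,m$. For $1\le d\le n$, $I_{n,d}$ is the ideal of $S$ generated by all squarefree monomials of degree $d$. If $I\subseteq J$ are monomial ideals with $G(I)\subseteq G(J)$, then $I$ can be extended to $J$ by linear quotients if the set $G(J)\setminus G(I)$ can be ordered as $v_1,\dots,v_r$ such that $(I,v_1,\dots,v_{j-1}):v_j$ is generated by variables for all $j=1,\dots,r$ (for $r=0$ the condition is vacuous). *)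

theory Defs
  imports "HOL-Library.Poly_Mapping" "HOL-Algebra.Ideal_Product"
begin

text \<open>
  A polynomial is a finitely supported map from exponent vectors to coefficients, and an exponent
  vector is a finitely supported map from variable indices to exponents. The ring
  \<open>K[x\<^sub>1,\<dots>,x\<^sub>n]\<close> is carved out of this type (which has infinitely many variables), so that
  \<open>n\<close> can be quantified over inside a formula. The field \<open>K\<close> is a type.
\<close>

type_synonym 'k mpoly = "(nat \<Rightarrow>\<^sub>0 nat) \<Rightarrow>\<^sub>0 'k"

definition mpoly_ring :: "nat \<Rightarrow> 'k::field mpoly ring" where
  "mpoly_ring n =
     \<lparr>carrier = {p. \<forall>e \<in> Poly_Mapping.keys p. Poly_Mapping.keys e \<subseteq> {1..n}},
      mult = (*), one = 1, zero = 0, add = (+)\<rparr>"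

definition variables :: "nat \<Rightarrow> 'k::field mpoly set" where
  "variables n = (\<lambda>i. Poly_Mapping.single (Poly_Mapping.single i 1) 1) ` {1..n}"

definition monomial_of :: "(nat \<Rightarrow>\<^sub>0 nat) \<Rightarrow> 'k::field mpoly" where
  "monomial_of e = Poly_Mapping.single e 1"

definition monomials :: "nat \<Rightarrow> 'k::field mpoly set" where
  "monomials n = {monomial_of e |e. Poly_Mapping.keys e \<subseteq> {1..n}}"

definition squarefree_monomials :: "nat \<Rightarrow> 'k::field mpoly set" where
  "squarefree_monomials n =
     {monomial_of e |e. Poly_Mapping.keys e \<subseteq> {1..n} \<and> (\<forall>i. Poly_Mapping.lookup e i \<le> 1)}"

definition squarefree_monomials_of_degree :: "nat \<Rightarrow> nat \<Rightarrow> 'k::field mpoly set" where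
  "squarefree_monomials_of_degree n d =
     {monomial_of e |e. Poly_Mapping.keys e \<subseteq> {1..n} \<and> (\<forall>i. Poly_Mapping.lookup e i \<le> 1) \<and>
                        (\<Sum>i = 1..n. Poly_Mapping.lookup e i) = d}"

text \<open>
  The generating sets may be empty: the zero ideal is a (squarefree) monomial ideal.
\<close>

definition monomial_ideal :: "nat \<Rightarrow> 'k::field mpoly set \<Rightarrow> bool" where
  "monomial_ideal n I \<longleftrightarrow> (\<exists>A \<subseteq> monomials n. I = Idl\<^bsub>mpoly_ring n\<^esub> A)"

definition squarefree_monomial_ideal :: "nat \<Rightarrow> 'k::field mpoly set \<Rightarrow> bool" where
  "squarefree_monomial_ideal n I \<longleftrightarrow>
     (\<exists>A \<subseteq> squarefree_monomials n. I = Idl\<^bsub>mpoly_ring n\<^esub> A)"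

definition min_monomial_generating_set ::
  "nat \<Rightarrow> 'k::field mpoly set \<Rightarrow> 'k mpoly set \<Rightarrow> bool" where
  "min_monomial_generating_set n I A \<longleftrightarrow>
     A \<subseteq> monomials n \<and> Idl\<^bsub>mpoly_ring n\<^esub> A = I \<and>
     (\<forall>B. B \<subset> A \<longrightarrow> Idl\<^bsub>mpoly_ring n\<^esub> B \<noteq> I)"

text \<open>
  The description below is justified by \<open>ex1_min_monomial_generating_set\<close>.
\<close>

definition min_gens :: "nat \<Rightarrow> 'k::field mpoly set \<Rightarrow> 'k mpoly set" where
  "min_gens n I = (THE A. min_monomial_generating_set n I A)"

definition colon_ideal ::
  "nat \<Rightarrow> 'k::field mpoly set \<Rightarrow> 'k mpoly \<Rightarrow> 'k mpoly set" where
  "colon_ideal n J u = {f \<in> carrier (mpoly_ring n). f \<otimes>\<^bsub>mpoly_ring n\<^esub> u \<in> J}"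

text \<open>
  The set of variables is allowed to be empty, so the zero ideal is generated by variables.
\<close>

definition generated_by_variables :: "nat \<Rightarrow> 'k::field mpoly set \<Rightarrow> bool" where
  "generated_by_variables n J \<longleftrightarrow> (\<exists>V \<subseteq> variables n. J = Idl\<^bsub>mpoly_ring n\<^esub> V)"

text \<open>
  Lists are indexed from 0: \<open>us ! j\<close> is the generator \<open>u\<^bsub>j+1\<^esub>\<close> and \<open>take j us\<close> lists
  \<open>u\<^sub>1,\<dots>,u\<^sub>j\<close>.
\<close>

definition has_linear_quotients :: "nat \<Rightarrow> 'k::field mpoly set \<Rightarrow> bool" where
  "has_linear_quotients n I \<longleftrightarrow>
     (\<exists>us. distinct us \<and> set us = min_gens n I \<and>
        (\<forall>j. 1 \<le> j \<and> j < length us \<longrightarrow>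
           generated_by_variables n
             (colon_ideal n (Idl\<^bsub>mpoly_ring n\<^esub> (set (take j us))) (us ! j))))"

definition extendable_by_linear_quotients ::
  "nat \<Rightarrow> 'k::field mpoly set \<Rightarrow> 'k mpoly set \<Rightarrow> bool" where
  "extendable_by_linear_quotients n I J \<longleftrightarrow>
     monomial_ideal n I \<and> monomial_ideal n J \<and> I \<subseteq> J \<and> min_gens n I \<subseteq> min_gens n J \<and>
     (\<exists>vs. distinct vs \<and> set vs = min_gens n J - min_gens n I \<and>
        (\<forall>j < length vs.
           generated_by_variables n
             (colon_ideal n (Idl\<^bsub>mpoly_ring n\<^esub> (I \<union> set (take j vs))) (vs ! j))))"

definition squarefree_veronese_ideal :: "nat \<Rightarrow> nat \<Rightarrow> 'k::field mpoly set" where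
  "squarefree_veronese_ideal n d = Idl\<^bsub>mpoly_ring n\<^esub> (squarefree_monomials_of_degree n d)"

definition max_ideal :: "nat \<Rightarrow> 'k::field mpoly set" where
  "max_ideal n = Idl\<^bsub>mpoly_ring n\<^esub> (variables n)"

text \<open>
  Powers are taken in the semiring of ideals of \<open>K[x\<^sub>1,\<dots>,x\<^sub>n]\<close>, whose multiplication is
  \<^const>\<open>ideal_prod\<close>.
\<close>

definition max_ideal_power :: "nat \<Rightarrow> nat \<Rightarrow> 'k::field mpoly set" where
  "max_ideal_power n d = max_ideal n [^]\<^bsub>ideals_set (mpoly_ring n)\<^esub> d"


section \<open>Well-definedness\<close>

lemma mpoly_ring_simps [simp]:
  "p \<in> carrier (mpoly_ring n) \<longleftrightarrow>
     (\<forall>e \<in> Poly_Mapping.keys p. Poly_Mapping.keys e \<subseteq> {1..n})"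
  "mult (mpoly_ring n) = (*)" "one (mpoly_ring n) = 1"
  "zero (mpoly_ring n) = 0" "add (mpoly_ring n) = (+)"
  by (simp_all add: mpoly_ring_def)

lemma keys_add_nat:
  "Poly_Mapping.keys (a + b :: nat \<Rightarrow>\<^sub>0 nat) = Poly_Mapping.keys a \<union> Poly_Mapping.keys b"
  by (auto simp: in_keys_iff lookup_add)

lemma mpoly_ring_mult_closed:
  assumes "p \<in> carrier (mpoly_ring n)" "q \<in> carrier (mpoly_ring n)"
  shows "p * q \<in> carrier (mpoly_ring n)"
proof -
  have "Poly_Mapping.keys e \<subseteq> {1..n}" if e: "e \<in> Poly_Mapping.keys (p * q)" for e
  proof -
    obtain a b where "a \<in> Poly_Mapping.keys p" "b \<in> Poly_Mapping.keys q" "e = a + b"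
      using e keys_mult[of p q] by blast
    then show ?thesis
      using assms by (simp add: keys_add_nat)
  qed
  then show ?thesis by simp
qed

lemma mpoly_ring_add_closed:
  assumes "p \<in> carrier (mpoly_ring n)" "q \<in> carrier (mpoly_ring n)"
  shows "p + q \<in> carrier (mpoly_ring n)"
  using assms Poly_Mapping.keys_add[of p q] by auto

lemma mpoly_ring_uminus_closed:
  "p \<in> carrier (mpoly_ring n) \<Longrightarrow> - p \<in> carrier (mpoly_ring n)"
  by (simp add: in_keys_iff)

lemma cring_mpoly_ring: "cring (mpoly_ring n :: 'k::field mpoly ring)"
proof (rule cringI)
  show "abelian_group (mpoly_ring n :: 'k mpoly ring)"
  proof (rule abelian_groupI)
    fix p :: "'k mpoly"
    assume "p \<in> carrier (mpoly_ring n)"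
    then have "- p \<in> carrier (mpoly_ring n)"
      by (rule mpoly_ring_uminus_closed)
    then show "\<exists>q \<in> carrier (mpoly_ring n). q \<oplus>\<^bsub>mpoly_ring n\<^esub> p = \<zero>\<^bsub>mpoly_ring n\<^esub>"
      by (intro bexI[of _ "- p"]) simp_all
  next
    fix p q :: "'k mpoly"
    assume "p \<in> carrier (mpoly_ring n)" "q \<in> carrier (mpoly_ring n)"
    then show "p \<oplus>\<^bsub>mpoly_ring n\<^esub> q \<in> carrier (mpoly_ring n)"
      using mpoly_ring_add_closed by simp
  qed (simp_all add: ac_simps)
  show "comm_monoid (mpoly_ring n :: 'k mpoly ring)"
  proof (rule comm_monoidI)
    fix p q :: "'k mpoly"
    assume "p \<in> carrier (mpoly_ring n)" "q \<in> carrier (mpoly_ring n)"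
    then show "p \<otimes>\<^bsub>mpoly_ring n\<^esub> q \<in> carrier (mpoly_ring n)"
      using mpoly_ring_mult_closed by simp
  qed (simp_all add: ac_simps)
qed (simp_all add: distrib_right)

text \<open>
  \<open>span_of n E\<close> is the ideal generated by the monomials with exponents in \<open>E\<close>.
\<close>

definition span_of :: "nat \<Rightarrow> (nat \<Rightarrow>\<^sub>0 nat) set \<Rightarrow> 'k::field mpoly set" where
  "span_of n E = {p \<in> carrier (mpoly_ring n). \<forall>e \<in> Poly_Mapping.keys p. \<exists>a \<in> E. \<exists>c. e = a + c}"

lemma ideal_span_of: "ideal (span_of n E :: 'k::field mpoly set) (mpoly_ring n)"
proof -
  interpret cring "mpoly_ring n :: 'k mpoly ring" by (rule cring_mpoly_ring)
  have mult: "x * a \<in> span_of n E"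
    if a: "a \<in> span_of n E" and x: "x \<in> carrier (mpoly_ring n)" for a x :: "'k mpoly"
  proof -
    have "\<exists>b \<in> E. \<exists>c. e = b + c" if e: "e \<in> Poly_Mapping.keys (x * a)" for e
    proof -
      obtain u v where uv: "v \<in> Poly_Mapping.keys a" "e = u + v"
        using e keys_mult[of x a] by blast
      then obtain b c where b: "b \<in> E" and v: "v = b + c"
        using a by (auto simp: span_of_def)
      have "e = b + (c + u)"
        unfolding uv(2) v by (simp add: ac_simps)
      with b show ?thesis by blast
    qed
    then show ?thesis
      using mpoly_ring_mult_closed[OF x, of a] a by (simp add: span_of_def)
  qed
  show ?thesis
  proof (rule idealI)
    show "subgroup (span_of n E :: 'k mpoly set) (add_monoid (mpoly_ring n))"
    proof (rule add.subgroupI)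
      show "(span_of n E :: 'k mpoly set) \<subseteq> carrier (mpoly_ring n)"
        by (auto simp: span_of_def)
      have "0 \<in> (span_of n E :: 'k mpoly set)"
        by (simp add: span_of_def)
      then show "(span_of n E :: 'k mpoly set) \<noteq> {}" by blast
    next
      fix a :: "'k mpoly"
      assume a: "a \<in> span_of n E"
      then have car: "a \<in> carrier (mpoly_ring n)" by (simp add: span_of_def)
      have "\<ominus>\<^bsub>mpoly_ring n\<^esub> a = - a"
        using car by (intro minus_equality) (simp_all add: in_keys_iff)
      with a show "\<ominus>\<^bsub>mpoly_ring n\<^esub> a \<in> span_of n E"
        by (simp add: span_of_def in_keys_iff)
    next
      fix a b :: "'k mpoly"
      assume "a \<in> span_of n E" "b \<in> span_of n E"
      then show "a \<oplus>\<^bsub>mpoly_ring n\<^esub> b \<in> span_of n E"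
        using Poly_Mapping.keys_add[of a b] mpoly_ring_add_closed[of a n b]
        unfolding span_of_def by (simp del: mpoly_ring_simps(1) add: mpoly_ring_simps(5)) blast
    qed
  qed (use mult in \<open>simp_all add: ring_axioms mult.commute\<close>)
qed

lemma monomial_of_carrier:
  "Poly_Mapping.keys e \<subseteq> {1..n} \<Longrightarrow> monomial_of e \<in> carrier (mpoly_ring n)"
  by (simp add: monomial_of_def)

lemma poly_sum_singles:
  "p = (\<Sum>e \<in> Poly_Mapping.keys p. Poly_Mapping.single e (Poly_Mapping.lookup p e))"
  by (rule poly_mapping_eqI)
     (simp add: lookup_sum lookup_single when_def in_keys_iff)

lemma Idl_monomials:
  assumes E: "\<And>e. e \<in> E \<Longrightarrow> Poly_Mapping.keys e \<subseteq> {1..n}"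
  shows "Idl\<^bsub>mpoly_ring n\<^esub> (monomial_of ` E) = (span_of n E :: 'k::field mpoly set)"
proof
  interpret cring "mpoly_ring n :: 'k mpoly ring" by (rule cring_mpoly_ring)
  have sub: "monomial_of ` E \<subseteq> carrier (mpoly_ring n :: 'k mpoly ring)"
    using E monomial_of_carrier by blast
  have "monomial_of ` E \<subseteq> (span_of n E :: 'k mpoly set)"
  proof (rule image_subsetI)
    fix e assume e: "e \<in> E"
    have "\<exists>a \<in> E. \<exists>c. e = a + c"
      using e by (intro bexI[of _ e] exI[of _ 0]) simp_all
    then show "monomial_of e \<in> (span_of n E :: 'k mpoly set)"
      using E[OF e] by (simp add: span_of_def monomial_of_def)
  qed
  then show "Idl\<^bsub>mpoly_ring n\<^esub> (monomial_of ` E) \<subseteq> (span_of n E :: 'k mpoly set)"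
    by (rule genideal_minimal[OF ideal_span_of])
  let ?J = "Idl\<^bsub>mpoly_ring n\<^esub> (monomial_of ` E) :: 'k mpoly set"
  interpret J: ideal ?J "mpoly_ring n" by (rule genideal_ideal[OF sub])
  show "span_of n E \<subseteq> ?J"
  proof
    fix p :: "'k mpoly"
    assume p: "p \<in> span_of n E"
    have summand: "Poly_Mapping.single e (Poly_Mapping.lookup p e) \<in> ?J"
      if e: "e \<in> Poly_Mapping.keys p" for e
    proof -
      obtain a c where a: "a \<in> E" and eq: "e = a + c"
        using p e by (auto simp: span_of_def)
      have "Poly_Mapping.keys e \<subseteq> {1..n}"
        using p e by (simp add: span_of_def)
      then have "Poly_Mapping.keys c \<subseteq> {1..n}"
        by (simp add: eq keys_add_nat)
      then have c: "Poly_Mapping.single c (Poly_Mapping.lookup p e) \<in> carrier (mpoly_ring n)"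
        by simp
      have "monomial_of a \<in> ?J"
        using a genideal_self[OF sub] by blast
      from J.I_r_closed[OF this c] show ?thesis
        by (simp add: monomial_of_def mult_single eq)
    qed
    have "(\<Sum>e \<in> F. Poly_Mapping.single e (Poly_Mapping.lookup p e)) \<in> ?J"
      if "finite F" "F \<subseteq> Poly_Mapping.keys p" for F
      using that
    proof (induction F rule: finite_induct)
      case empty
      then show ?case using J.zero_closed by simp
    next
      case (insert e F)
      then show ?case using J.a_closed[OF summand[of e]] by simp
    qed
    from this[of "Poly_Mapping.keys p"] show "p \<in> ?J"
      by (simp flip: poly_sum_singles)
  qed
qed

lemma inj_monomial_of: "inj (monomial_of :: _ \<Rightarrow> 'k::field mpoly)"
proof (rule injI)
  fix a b :: "nat \<Rightarrow>\<^sub>0 nat"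
  assume "(monomial_of a :: 'k mpoly) = monomial_of b"
  then have "Poly_Mapping.keys (monomial_of a :: 'k mpoly) = Poly_Mapping.keys (monomial_of b :: 'k mpoly)"
    by simp
  then show "a = b" by (simp add: monomial_of_def)
qed

lemma monomial_of_in_span_of:
  "monomial_of e \<in> span_of n E \<longleftrightarrow>
     Poly_Mapping.keys e \<subseteq> {1..n} \<and> (\<exists>a \<in> E. \<exists>c. e = a + c)"
  by (auto simp: span_of_def monomial_of_def)

lemma subset_monomialsE:
  assumes "A \<subseteq> monomials n"
  obtains E where "A = monomial_of ` E" "\<And>e. e \<in> E \<Longrightarrow> Poly_Mapping.keys e \<subseteq> {1..n}"
proof
  show "A = monomial_of ` {e. monomial_of e \<in> A}"
    using assms by (auto simp: monomials_def)
  fix e assume "e \<in> {e. monomial_of e \<in> A}"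
  with assms obtain e' where "monomial_of e = (monomial_of e' :: 'a mpoly)"
    "Poly_Mapping.keys e' \<subseteq> {1..n}"
    by (auto simp: monomials_def)
  then show "Poly_Mapping.keys e \<subseteq> {1..n}"
    using injD[OF inj_monomial_of] by metis
qed

text \<open>
  The exponents of the monomials in \<open>span_of n E\<close> that are minimal with respect to divisibility.
\<close>

definition min_exponents :: "(nat \<Rightarrow>\<^sub>0 nat) set \<Rightarrow> (nat \<Rightarrow>\<^sub>0 nat) set" where
  "min_exponents E = {e \<in> E. \<forall>a \<in> E. \<forall>c. e = a + c \<longrightarrow> c = 0}"

lemma exponent_above_min:
  assumes "e \<in> E"
  shows "\<exists>a \<in> min_exponents E. \<exists>c. e = a + c"
  using assms
proof (induction "\<Sum>i \<in> Poly_Mapping.keys e. Poly_Mapping.lookup e i" arbitrary: e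
    rule: less_induct)
  case less
  show ?case
  proof (cases "e \<in> min_exponents E")
    case True
    then show ?thesis by (intro bexI[of _ e] exI[of _ 0]) simp_all
  next
    case False
    then obtain a c where a: "a \<in> E" and eq: "e = a + c" and "c \<noteq> 0"
      using less.prems by (auto simp: min_exponents_def)
    then obtain i where i: "i \<in> Poly_Mapping.keys c" by (metis keys_eq_empty equals0I)
    have "(\<Sum>i \<in> Poly_Mapping.keys a. Poly_Mapping.lookup a i) =
        (\<Sum>i \<in> Poly_Mapping.keys e. Poly_Mapping.lookup a i)"
      by (rule sum.mono_neutral_left) (auto simp: eq keys_add_nat in_keys_iff)
    also have "\<dots> < (\<Sum>i \<in> Poly_Mapping.keys e. Poly_Mapping.lookup e i)"
      using i by (intro sum_strict_mono_ex1)
        (auto simp: eq keys_add_nat lookup_add in_keys_iff intro!: bexI[of _ i])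
    finally obtain b d where "b \<in> min_exponents E" "a = b + d"
      using less.hyps a by blast
    then show ?thesis
      by (intro bexI[of _ b] exI[of _ "d + c"]) (simp_all add: eq ac_simps)
  qed
qed

lemma span_of_min_exponents: "span_of n (min_exponents E) = span_of n E"
proof -
  have "(\<exists>a \<in> min_exponents E. \<exists>c. e = a + c) \<longleftrightarrow> (\<exists>a \<in> E. \<exists>c. e = a + c)" for e
  proof
    assume "\<exists>a \<in> E. \<exists>c. e = a + c"
    then obtain a c where "a \<in> E" "e = a + c" by blast
    moreover obtain b d where "b \<in> min_exponents E" "a = b + d"
      using exponent_above_min[OF \<open>a \<in> E\<close>] by blast
    ultimately show "\<exists>a \<in> min_exponents E. \<exists>c. e = a + c"
      by (metis add.assoc)
  qed (auto simp: min_exponents_def)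
  then show ?thesis by (simp add: span_of_def)
qed

lemma min_exponents_subset:
  assumes E: "\<And>e. e \<in> E \<Longrightarrow> Poly_Mapping.keys e \<subseteq> {1..n}"
    and F: "\<And>e. e \<in> F \<Longrightarrow> Poly_Mapping.keys e \<subseteq> {1..n}"
    and eq: "(span_of n E :: 'k::field mpoly set) = span_of n F"
  shows "min_exponents E \<subseteq> F"
proof
  fix e assume e: "e \<in> min_exponents E"
  then have "e \<in> E" by (simp add: min_exponents_def)
  have mem: "\<exists>a \<in> G. \<exists>c. e' = a + c"
    if "e' \<in> F'" "\<And>e. e \<in> F' \<Longrightarrow> Poly_Mapping.keys e \<subseteq> {1..n}"
      "(span_of n F' :: 'k mpoly set) = span_of n G" for e' F' G
  proof -
    have "(monomial_of e' :: 'k mpoly) \<in> span_of n F'"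
      unfolding monomial_of_in_span_of using that(1,2)
      by (auto intro!: bexI[of _ e'] exI[of _ 0])
    then show ?thesis
      unfolding that(3) monomial_of_in_span_of by blast
  qed
  obtain f c where f: "f \<in> F" "e = f + c"
    using mem[OF \<open>e \<in> E\<close> E eq] by blast
  obtain a d where a: "a \<in> E" "f = a + d"
    using mem[OF f(1) F eq[symmetric]] by blast
  have "e = a + (d + c)"
    by (simp add: f a ac_simps)
  then have "d + c = 0"
    using e a(1) unfolding min_exponents_def by blast
  then have "Poly_Mapping.keys d \<union> Poly_Mapping.keys c = {}"
    using keys_add_nat[of d c] by simp
  then have "c = 0" by simp
  with f show "e \<in> F" by simp
qed

lemma min_monomial_generating_set_iff:
  fixes I :: "'k::field mpoly set"
  assumes E: "\<And>e. e \<in> E \<Longrightarrow> Poly_Mapping.keys e \<subseteq> {1..n}"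
    and I: "I = Idl\<^bsub>mpoly_ring n\<^esub> (monomial_of ` E)"
  shows "min_monomial_generating_set n I A \<longleftrightarrow> A = monomial_of ` min_exponents E"
proof -
  let ?M = "monomial_of ` min_exponents E :: 'k mpoly set"
  have sub: "min_exponents E \<subseteq> E" by (auto simp: min_exponents_def)
  then have ME: "\<And>e. e \<in> min_exponents E \<Longrightarrow> Poly_Mapping.keys e \<subseteq> {1..n}"
    using E by blast
  have IE: "I = span_of n E" unfolding I by (rule Idl_monomials[OF E])
  have gen: "Idl\<^bsub>mpoly_ring n\<^esub> ?M = I"
    by (simp add: Idl_monomials[OF ME] IE span_of_min_exponents)
  have least: "?M \<subseteq> B" if B: "B \<subseteq> monomials n" "Idl\<^bsub>mpoly_ring n\<^esub> B = I" for B
  proof -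
    obtain F where F: "B = monomial_of ` F" "\<And>e. e \<in> F \<Longrightarrow> Poly_Mapping.keys e \<subseteq> {1..n}"
      using subset_monomialsE[OF B(1)] by blast
    have "(span_of n E :: 'k mpoly set) = span_of n F"
      using B(2) IE Idl_monomials[OF F(2), where 'k = 'k] F(1) by simp
    from min_exponents_subset[OF E F(2) this] show ?thesis
      unfolding F(1) by blast
  qed
  have M: "?M \<subseteq> monomials n"
    using ME by (auto simp: monomials_def)
  show ?thesis
  proof
    assume A: "min_monomial_generating_set n I A"
    then have "?M \<subseteq> A" using least by (simp add: min_monomial_generating_set_def)
    moreover have "\<not> ?M \<subset> A"
      using A gen unfolding min_monomial_generating_set_def by blast
    ultimately show "A = ?M" by blast
  next
    assume "A = ?M"
    have "Idl\<^bsub>mpoly_ring n\<^esub> B \<noteq> I" if "B \<subset> ?M" for B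
      using least[of B] M that by blast
    with M gen show "min_monomial_generating_set n I A"
      by (simp add: min_monomial_generating_set_def \<open>A = ?M\<close>)
  qed
qed

lemma ex1_min_monomial_generating_set:
  assumes "monomial_ideal n I"
  shows "\<exists>!A. min_monomial_generating_set n I A"
proof -
  obtain A where A: "A \<subseteq> monomials n" "I = Idl\<^bsub>mpoly_ring n\<^esub> A"
    using assms by (auto simp: monomial_ideal_def)
  obtain E where E: "A = monomial_of ` E" "\<And>e. e \<in> E \<Longrightarrow> Poly_Mapping.keys e \<subseteq> {1..n}"
    using subset_monomialsE[OF A(1)] by blast
  show ?thesis
    using min_monomial_generating_set_iff[OF E(2), of E I] A(2) E(1) by auto
qed

end

theory Submission
  imports Defs "HOL-Library.Nat_Bijection"
begin

text \<open>
  In a fixed degree both statements are about finite sets of exponent vectors. Adding a monomial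
  \<open>u\<close> to an ideal generated by monomials of the same degree gives a colon ideal generated by
  variables iff for every old generator \<open>a\<close> some old generator \<open>b\<close> is of the form
  \<open>u x\<^sub>l / x\<^sub>t\<close> where \<open>x\<^sub>l\<close> divides \<open>a / gcd(a, u)\<close>
  (\<open>linear_step\<close>, \<open>generated_by_variables_iff_linear_step\<close>). Linear quotients
  and extensions are chains of such steps (\<open>extends\<close>), starting at the empty set and at
  the given set respectively.

  The monomial statement implies the squarefree one because deleting all monomials that are not
  squarefree from a chain leaves a chain (\<open>extends_squarefree\<close>): if \<open>u\<close> and \<open>a\<close>
  are squarefree, then \<open>x\<^sub>l\<close> does not divide \<open>u\<close>, and so
  \<open>u x\<^sub>l / x\<^sub>t\<close> is squarefree too.

  For the converse, replace every variable by \<open>d\<close> copies of itself. A set of copies has a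
  shadow, the monomial in the original variables obtained by identifying the copies of each
  variable. Given a set \<open>E\<close> of monomials of degree \<open>d\<close> with linear quotients, the squarefree
  monomials whose shadow lies in \<open>E\<close> have linear quotients as well: the preimages of the
  monomials of \<open>E\<close> are added block by block, each block in a suitable order
  (\<open>extends_preimage\<close>). If \<open>E\<close> does not contain all monomials of degree \<open>d\<close>, the
  squarefree statement therefore provides a next squarefree monomial \<open>S\<close>. Its shadow can be
  adjoined to \<open>E\<close> (\<open>linear_step_shadow\<close>): every \<open>a \<in> E\<close> is the shadow of some
  \<open>T\<close> that on the copies of each single variable is comparable with \<open>S\<close> under
  inclusion, so that a copy of \<open>x\<^sub>l\<close> can lie in \<open>T - S\<close> only if \<open>a\<close> has the
  larger exponent at \<open>x\<^sub>l\<close>. Only the first monomial of the extension is used; the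
  argument is then repeated with the enlarged set until all monomials of degree \<open>d\<close> are
  reached (\<open>extends_exponents\<close>).
\<close>

section \<open>Adding monomials one at a time\<close>

text \<open>
  The exchange condition that, among exponents of one degree, says that the ideal generated by
  \<open>A\<close> has a colon ideal by \<open>u\<close> generated by variables. Since \<open>b\<close> has the degree of
  \<open>u\<close>, it equals \<open>u x\<^sub>l / x\<^sub>t\<close>; the equation avoids the division.
\<close>

definition linear_step :: "(nat \<Rightarrow>\<^sub>0 nat) set \<Rightarrow> (nat \<Rightarrow>\<^sub>0 nat) \<Rightarrow> bool" where
  "linear_step A u \<longleftrightarrow>
     (\<forall>a \<in> A. \<exists>b \<in> A. \<exists>l t. Poly_Mapping.lookup u l < Poly_Mapping.lookup a l \<and>
        b + Poly_Mapping.single t 1 = u + Poly_Mapping.single l 1)"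

text \<open>
  \<open>extends A B\<close> holds if \<open>B\<close> is obtained from \<open>A\<close> by finitely many linear steps. In
  particular \<open>extends {} B\<close> expresses that \<open>B\<close> has linear quotients.
\<close>

inductive extends :: "(nat \<Rightarrow>\<^sub>0 nat) set \<Rightarrow> (nat \<Rightarrow>\<^sub>0 nat) set \<Rightarrow> bool" for A where
  start: "extends A A"
| adjoin: "extends A B \<Longrightarrow> u \<notin> B \<Longrightarrow> linear_step B u \<Longrightarrow> extends A (insert u B)"

lemma extends_trans: "extends B C \<Longrightarrow> extends A B \<Longrightarrow> extends A C"
  by (induction rule: extends.induct) (auto intro: extends.adjoin)

lemma extends_first_step:
  assumes "extends A B" "A \<noteq> B"
  shows "\<exists>u \<in> B - A. linear_step A u"
  using assms by (induction rule: extends.induct) auto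

lemma extends_iff_list:
  "extends A B \<longleftrightarrow>
     A \<subseteq> B \<and> (\<exists>vs. distinct vs \<and> set vs = B - A \<and>
       (\<forall>j < length vs. linear_step (A \<union> set (take j vs)) (vs ! j)))"
    (is "_ \<longleftrightarrow> ?R B")
proof
  show "extends A B \<Longrightarrow> ?R B"
  proof (induction rule: extends.induct)
    case start
    show ?case by (auto intro!: exI[of _ "[]"])
  next
    case (adjoin B u)
    from adjoin.IH obtain vs where vs: "A \<subseteq> B" "distinct vs" "set vs = B - A"
      "\<And>j. j < length vs \<Longrightarrow> linear_step (A \<union> set (take j vs)) (vs ! j)"
      by blast
    have "A \<union> set vs = B" using vs(1,3) by blast
    then have "linear_step (A \<union> set (take j (vs @ [u]))) ((vs @ [u]) ! j)"
      if "j < length (vs @ [u])" for j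
      using vs(4)[of j] that adjoin.hyps(3) by (cases "j < length vs") (auto simp: nth_append)
    then show ?case
      using vs adjoin.hyps(2) by (intro conjI exI[of _ "vs @ [u]"]) auto
  qed
next
  have "extends A (A \<union> set vs)"
    if "distinct vs" "set vs \<inter> A = {}"
      "\<forall>j < length vs. linear_step (A \<union> set (take j vs)) (vs ! j)" for vs
    using that
  proof (induction vs rule: rev_induct)
    case Nil
    then show ?case by (simp add: extends.start)
  next
    case (snoc u vs)
    have "linear_step (A \<union> set (take j vs)) (vs ! j)" if "j < length vs" for j
      using snoc.prems(3)[rule_format, of j] that by (simp add: nth_append)
    with snoc have "extends A (A \<union> set vs)" by simp
    moreover have "linear_step (A \<union> set vs) u"
      using snoc.prems(3)[rule_format, of "length vs"] by simp
    ultimately have "extends A (insert u (A \<union> set vs))"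
      using snoc.prems by (intro extends.adjoin) auto
    then show ?case by simp
  qed
  note list = this
  assume "?R B"
  then obtain vs where vs: "A \<subseteq> B" "distinct vs" "set vs = B - A"
    "\<forall>j < length vs. linear_step (A \<union> set (take j vs)) (vs ! j)" by blast
  moreover have "A \<union> set vs = B" "set vs \<inter> A = {}" using vs(1,3) by blast+
  ultimately show "extends A B" using list[of vs] by simp
qed

section \<open>Exponents of a fixed degree\<close>

text \<open>
  The exponents of the monomials, and of the squarefree monomials, of degree \<open>d\<close> in
  \<open>x\<^sub>1,\<dots>,x\<^sub>n\<close>.
\<close>

definition exponents :: "nat \<Rightarrow> nat \<Rightarrow> (nat \<Rightarrow>\<^sub>0 nat) set" where
  "exponents n d =
     {e. Poly_Mapping.keys e \<subseteq> {1..n} \<and> (\<Sum>i = 1..n. Poly_Mapping.lookup e i) = d}"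

definition squarefree_exponents :: "nat \<Rightarrow> nat \<Rightarrow> (nat \<Rightarrow>\<^sub>0 nat) set" where
  "squarefree_exponents n d = {e \<in> exponents n d. \<forall>i. Poly_Mapping.lookup e i \<le> 1}"

lemma squarefree_exponents_subset: "squarefree_exponents n d \<subseteq> exponents n d"
  by (auto simp: squarefree_exponents_def)

lemma exponents_keys: "e \<in> exponents n d \<Longrightarrow> Poly_Mapping.keys e \<subseteq> {1..n}"
  by (simp add: exponents_def)

lemma finite_exponents: "finite (exponents n d)"
proof -
  have "Poly_Mapping.lookup ` exponents n d \<subseteq>
      {f. f ` {1..n} \<subseteq> {0..d} \<and> (\<forall>i. i \<notin> {1..n} \<longrightarrow> f i = 0)}"
  proof clarsimp
    fix e assume e: "e \<in> exponents n d"
    have "Poly_Mapping.lookup e i \<le> d" if "i \<in> {1..n}" for i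
      using e member_le_sum[of i "{1..n}" "Poly_Mapping.lookup e"] that
      by (simp add: exponents_def)
    moreover have "Poly_Mapping.lookup e i = 0" if "i \<notin> {1..n}" for i
      using e that by (auto simp: exponents_def in_keys_iff)
    ultimately show "Poly_Mapping.lookup e ` {Suc 0..n} \<subseteq> {0..d} \<and>
        (\<forall>i. (Suc 0 \<le> i \<longrightarrow> \<not> i \<le> n) \<longrightarrow> Poly_Mapping.lookup e i = 0)" by auto
  qed
  moreover have "finite {f. f ` {1..n} \<subseteq> {0..d} \<and> (\<forall>i. i \<notin> {1..n} \<longrightarrow> f i = (0::nat))}"
    using finite_set_of_finite_funs[of "{1..n}" "{0..d}" 0]
    by (rule rev_finite_subset) (auto simp: image_subset_iff)
  ultimately have "finite (Poly_Mapping.lookup ` exponents n d)"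
    by (rule finite_subset)
  then show ?thesis
    by (rule finite_imageD) (simp add: inj_on_def)
qed

lemma sum_lookup_add:
  "(\<Sum>i \<in> A. Poly_Mapping.lookup (a + b) i) =
     (\<Sum>i \<in> A. Poly_Mapping.lookup a i) + (\<Sum>i \<in> A. Poly_Mapping.lookup b i)"
  by (simp add: lookup_add sum.distrib)

lemma sum_lookup_single:
  assumes "finite A" "i \<in> A"
  shows "(\<Sum>j \<in> A. Poly_Mapping.lookup (Poly_Mapping.single i c) j) = c"
  using assms by (simp add: lookup_single when_def)

lemma ex_add_iff: "(\<exists>c. e = a + (c :: nat \<Rightarrow>\<^sub>0 nat)) \<longleftrightarrow>
    (\<forall>i. Poly_Mapping.lookup a i \<le> Poly_Mapping.lookup e i)"
proof
  assume le: "\<forall>i. Poly_Mapping.lookup a i \<le> Poly_Mapping.lookup e i"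
  have "e = a + (e - a)"
    using le by (intro poly_mapping_eqI) (simp add: lookup_add lookup_minus)
  then show "\<exists>c. e = a + c" ..
qed (auto simp: lookup_add)

lemma degree_one_exponent:
  fixes c :: "nat \<Rightarrow>\<^sub>0 nat"
  assumes "Poly_Mapping.keys c \<subseteq> {1..n}" "(\<Sum>i = 1..n. Poly_Mapping.lookup c i) = 1"
  shows "\<exists>t. c = Poly_Mapping.single t 1"
proof -
  obtain t where t: "t \<in> {1..n}" "Poly_Mapping.lookup c t = 1"
    "\<And>i. i \<in> {1..n} \<Longrightarrow> i \<noteq> t \<Longrightarrow> Poly_Mapping.lookup c i = 0"
    using iffD1[OF sum_eq_1_iff[OF finite_atLeastAtMost] assms(2)] by metis
  have "Poly_Mapping.lookup c i = 0" if "i \<noteq> t" for i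
    using t(3)[of i] that assms(1) by (cases "i \<in> {1..n}") (auto simp: in_keys_iff)
  then have "c = Poly_Mapping.single t 1"
    using t(2) by (intro poly_mapping_eqI) (auto simp: lookup_single when_def)
  then show ?thesis ..
qed

lemma extends_squarefree:
  assumes "extends A B" and "\<And>u. u \<in> B \<Longrightarrow> u \<in> exponents n d"
  shows "extends (A \<inter> squarefree_exponents n d) (B \<inter> squarefree_exponents n d)"
  using assms
proof (induction rule: extends.induct)
  case start
  show ?case by (rule extends.start)
next
  case (adjoin B u)
  let ?Q = "squarefree_exponents n d"
  have IH: "extends (A \<inter> ?Q) (B \<inter> ?Q)" using adjoin by blast
  show ?case
  proof (cases "u \<in> ?Q")
    case False
    with IH show ?thesis by simp
  next
    case True
    have "linear_step (B \<inter> ?Q) u"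
      unfolding linear_step_def
    proof
      fix a assume a: "a \<in> B \<inter> ?Q"
      then obtain b l t where b: "b \<in> B"
        and lt: "Poly_Mapping.lookup u l < Poly_Mapping.lookup a l"
        and eq: "b + Poly_Mapping.single t 1 = u + Poly_Mapping.single l 1"
        using adjoin.hyps(3) unfolding linear_step_def by blast
      \<comment> \<open>As \<open>a\<close> is squarefree, \<open>x\<^sub>l\<close> does not divide \<open>u\<close>.\<close>
      have "Poly_Mapping.lookup a l \<le> 1"
        using a by (simp add: squarefree_exponents_def)
      then have u0: "Poly_Mapping.lookup u l = 0" using lt by simp
      have "Poly_Mapping.lookup b i \<le> 1" for i
      proof -
        have "Poly_Mapping.lookup u i \<le> 1"
          using True by (simp add: squarefree_exponents_def)
        moreover have "Poly_Mapping.lookup b i \<le>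
            Poly_Mapping.lookup u i + (if i = l then 1 else 0)"
          using arg_cong[OF eq, of "\<lambda>e. Poly_Mapping.lookup e i"]
          by (auto simp: lookup_add lookup_single when_def split: if_splits)
        ultimately show ?thesis using u0 by (cases "i = l") auto
      qed
      then have "b \<in> B \<inter> ?Q"
        using b adjoin.prems by (auto simp: squarefree_exponents_def)
      with lt eq show "\<exists>b \<in> B \<inter> ?Q. \<exists>l t. Poly_Mapping.lookup u l < Poly_Mapping.lookup a l \<and>
          b + Poly_Mapping.single t 1 = u + Poly_Mapping.single l 1"
        by blast
    qed
    then have "extends (A \<inter> ?Q) (insert u (B \<inter> ?Q))"
      using IH adjoin.hyps(2) by (intro extends.adjoin) auto
    with True show ?thesis by simp
  qed
qed

section \<open>Sets as squarefree exponents, and their shadows\<close>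

text \<open>
  A set \<open>S\<close> of variable indices stands for the squarefree monomial \<open>\<Prod>p\<in>S. x\<^sub>p\<close>. Its
  shadow is the exponent of the monomial \<open>\<Prod>p\<in>S. x\<^bsub>f p\<^esub>\<close> obtained by substituting
  \<open>x\<^bsub>f p\<^esub>\<close> for \<open>x\<^sub>p\<close>.
\<close>

definition shadow :: "(nat \<Rightarrow> nat) \<Rightarrow> nat set \<Rightarrow> (nat \<Rightarrow>\<^sub>0 nat)" where
  "shadow f S = (\<Sum>p \<in> S. Poly_Mapping.single (f p) 1)"

text \<open>
  The exponent of the squarefree monomial itself is the shadow under the identity.
\<close>

abbreviation indicator_exponent :: "nat set \<Rightarrow> (nat \<Rightarrow>\<^sub>0 nat)" where
  "indicator_exponent \<equiv> shadow (\<lambda>p. p)"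

lemma lookup_shadow:
  assumes "finite S"
  shows "Poly_Mapping.lookup (shadow f S) i = card {p \<in> S. f p = i}"
  using assms by (simp add: shadow_def lookup_sum lookup_single when_def flip: sum.inter_filter)

lemma lookup_indicator_exponent:
  assumes "finite S"
  shows "Poly_Mapping.lookup (indicator_exponent S) i = (if i \<in> S then 1 else 0)"
proof -
  have "{p \<in> S. p = i} = (if i \<in> S then {i} else {})" by auto
  then show ?thesis by (simp add: lookup_shadow[OF assms])
qed

lemma indicator_exponent_inj:
  assumes "finite S" "finite T" "indicator_exponent S = indicator_exponent T"
  shows "S = T"
proof -
  have "i \<in> S \<longleftrightarrow> i \<in> T" for i
    using arg_cong[OF assms(3), of "\<lambda>e. Poly_Mapping.lookup e i"]
    by (simp add: lookup_indicator_exponent assms(1,2) split: if_splits)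
  then show ?thesis by blast
qed

lemma shadow_exchange:
  assumes "finite S" "l \<notin> S" "t \<in> S"
  shows "shadow f (insert l (S - {t})) + Poly_Mapping.single (f t) 1 =
    shadow f S + Poly_Mapping.single (f l) 1"
proof -
  have "shadow f S = Poly_Mapping.single (f t) 1 + shadow f (S - {t})"
    unfolding shadow_def by (rule sum.remove[OF assms(1,3)])
  moreover have "shadow f (insert l (S - {t})) = Poly_Mapping.single (f l) 1 + shadow f (S - {t})"
    unfolding shadow_def using assms by (intro sum.insert) auto
  ultimately show ?thesis by (simp add: ac_simps)
qed

lemma linear_step_indicator_iff:
  assumes fin: "finite S" "\<And>T. T \<in> F \<Longrightarrow> finite T" and "S \<notin> F"
  shows "linear_step (indicator_exponent ` F) (indicator_exponent S) \<longleftrightarrow>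
    (\<forall>T \<in> F. \<exists>l \<in> T - S. \<exists>t \<in> S. insert l (S - {t}) \<in> F)"
proof -
  have neighbour: "(\<exists>B \<in> F. indicator_exponent B + Poly_Mapping.single t 1 =
        indicator_exponent S + Poly_Mapping.single l 1) \<longleftrightarrow>
      t \<in> S \<and> insert l (S - {t}) \<in> F" if l: "l \<notin> S" for l t
  proof
    assume "t \<in> S \<and> insert l (S - {t}) \<in> F"
    then show "\<exists>B \<in> F. indicator_exponent B + Poly_Mapping.single t 1 =
        indicator_exponent S + Poly_Mapping.single l 1"
      using shadow_exchange[OF fin(1) l, of t "\<lambda>p. p"] by blast
  next
    assume "\<exists>B \<in> F. indicator_exponent B + Poly_Mapping.single t 1 =
        indicator_exponent S + Poly_Mapping.single l 1"
    then obtain B where B: "B \<in> F" and eq: "indicator_exponent B + Poly_Mapping.single t 1 =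
        indicator_exponent S + Poly_Mapping.single l 1" by blast
    have "t \<noteq> l"
    proof
      assume "t = l"
      with eq have "indicator_exponent B = indicator_exponent S" by simp
      then show False using indicator_exponent_inj fin B \<open>S \<notin> F\<close> by metis
    qed
    have look: "(if i \<in> B then 1 else 0) + (if i = t then 1 else 0) =
        (if i \<in> S then 1 else 0) + (if i = l then 1 else (0::nat))" for i
      using arg_cong[OF eq, of "\<lambda>e. Poly_Mapping.lookup e i"] fin(1) fin(2)[OF B]
      by (auto simp: lookup_add lookup_single when_def lookup_indicator_exponent split: if_splits)
    have "t \<in> S" using look[of t] \<open>t \<noteq> l\<close> by (auto split: if_splits)
    moreover have "i \<in> B \<longleftrightarrow> i \<in> insert l (S - {t})" for i
      using look[of i] l \<open>t \<noteq> l\<close> by (auto split: if_splits)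
    then have "B = insert l (S - {t})" by blast
    ultimately show "t \<in> S \<and> insert l (S - {t}) \<in> F" using B by simp
  qed
  have lookup_less: "Poly_Mapping.lookup (indicator_exponent S) l <
      Poly_Mapping.lookup (indicator_exponent T) l \<longleftrightarrow> l \<in> T - S" if "T \<in> F" for T l
    using fin that by (simp add: lookup_indicator_exponent)
  have "linear_step (indicator_exponent ` F) (indicator_exponent S) \<longleftrightarrow>
    (\<forall>T \<in> F. \<exists>l t. Poly_Mapping.lookup (indicator_exponent S) l <
        Poly_Mapping.lookup (indicator_exponent T) l \<and>
      (\<exists>B \<in> F. indicator_exponent B + Poly_Mapping.single t 1 =
        indicator_exponent S + Poly_Mapping.single l 1))"
    unfolding linear_step_def by blast
  also have "\<dots> \<longleftrightarrow>
    (\<forall>T \<in> F. \<exists>l t. l \<in> T - S \<and> t \<in> S \<and> insert l (S - {t}) \<in> F)"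
    by (simp add: neighbour lookup_less del: One_nat_def cong: conj_cong)
  finally show ?thesis by blast
qed

lemma squarefree_exponents_eq:
  "squarefree_exponents n d = indicator_exponent ` {S. S \<subseteq> {1..n} \<and> card S = d}"
proof
  show "indicator_exponent ` {S. S \<subseteq> {1..n} \<and> card S = d} \<subseteq> squarefree_exponents n d"
  proof clarify
    fix S assume S: "S \<subseteq> {1..n}"
    then have fin: "finite S" by (rule finite_subset) simp
    have "{1..n} \<inter> S = S" using S by blast
    then have "(\<Sum>i = 1..n. Poly_Mapping.lookup (indicator_exponent S) i) = card S"
      by (simp add: lookup_indicator_exponent[OF fin] flip: sum.inter_restrict)
    then show "indicator_exponent S \<in> squarefree_exponents n (card S)"
      using S by (auto simp: squarefree_exponents_def exponents_def in_keys_iff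
          lookup_indicator_exponent[OF fin] split: if_splits)
  qed
  show "squarefree_exponents n d \<subseteq> indicator_exponent ` {S. S \<subseteq> {1..n} \<and> card S = d}"
  proof
    fix e assume e: "e \<in> squarefree_exponents n d"
    let ?S = "Poly_Mapping.keys e"
    have le: "Poly_Mapping.lookup e i \<le> 1" for i
      using e by (simp add: squarefree_exponents_def)
    have look: "Poly_Mapping.lookup e i = (if i \<in> ?S then 1 else 0)" for i
      using le[of i] by (auto simp: in_keys_iff)
    have sub: "?S \<subseteq> {1..n}"
      using e by (simp add: squarefree_exponents_def exponents_def)
    then have "{1..n} \<inter> ?S = ?S" by blast
    then have "(\<Sum>i = 1..n. Poly_Mapping.lookup e i) = card ?S"
      by (simp add: look[abs_def] flip: sum.inter_restrict)
    then have "card ?S = d"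
      using e by (simp add: squarefree_exponents_def exponents_def)
    moreover have "e = indicator_exponent ?S"
      by (rule poly_mapping_eqI) (simp add: lookup_indicator_exponent look[symmetric])
    ultimately show "e \<in> indicator_exponent ` {S. S \<subseteq> {1..n} \<and> card S = d}"
      using sub by blast
  qed
qed

section \<open>Linear quotients of the full preimage\<close>

lemma set_encode_less_max:
  assumes "finite S" "finite T" "set_encode T < set_encode S"
  shows "\<exists>m \<in> S - T. \<forall>p \<in> T - S. p < m"
proof -
  let ?D = "(S - T) \<union> (T - S)"
  have "S \<noteq> T" using assms(3) by blast
  then have "?D \<noteq> {}" by blast
  moreover have fin: "finite ?D" using assms by simp
  ultimately have mem: "Max ?D \<in> ?D" by (rule Max_in[rotated])
  have ge: "p \<le> Max ?D" if "p \<in> ?D" for p using fin that by (rule Max_ge)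
  define m where "m = Max ?D"
  have "m \<in> S"
  proof (rule ccontr)
    assume "m \<notin> S"
    then have m: "m \<in> T - S" using mem by (auto simp: m_def)
    have "S - T \<subseteq> {..<m}"
    proof
      fix p assume p: "p \<in> S - T"
      then have "p \<le> m" using ge[of p] by (simp add: m_def)
      moreover have "p \<noteq> m" using p m by blast
      ultimately show "p \<in> {..<m}" by simp
    qed
    then have "sum ((^) 2) (S - T) \<le> sum ((^) (2::nat)) {..<m}"
      by (intro sum_mono2) (auto simp: assms)
    also have "\<dots> < (2::nat) ^ m"
      by (induction m) auto
    also have "\<dots> \<le> sum ((^) 2) (T - S)"
      using m assms(2) by (intro member_le_sum) auto
    finally have "sum ((^) 2) (S - T) < sum ((^) (2::nat)) (T - S)" .
    moreover have "set_encode S = sum ((^) 2) (S - T) + sum ((^) 2) (S \<inter> T)"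
      unfolding set_encode_def using assms(1,2)
      by (subst sum.union_disjoint[symmetric]) (auto intro!: sum.cong)
    moreover have "set_encode T = sum ((^) 2) (T - S) + sum ((^) 2) (S \<inter> T)"
      unfolding set_encode_def using assms(1,2)
      by (subst sum.union_disjoint[symmetric]) (auto intro!: sum.cong)
    ultimately show False using assms(3) by simp
  qed
  then have "m \<in> S - T" using mem by (auto simp: m_def)
  moreover have "p < m" if "p \<in> T - S" for p
  proof -
    have "p \<le> m" using ge[of p] that by (simp add: m_def)
    moreover have "p \<noteq> m" using that \<open>m \<in> S\<close> by blast
    ultimately show ?thesis by simp
  qed
  ultimately show ?thesis by blast
qed

text \<open>
  The squarefree monomials with a common shadow are ordered by \<^const>\<open>set_encode\<close>. For
  \<open>T\<close> before \<open>S\<close>, the largest element \<open>t\<close> in which they differ lies in \<open>S\<close>; as both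
  contain the same number of elements over \<open>f t\<close>, it can be exchanged for a smaller \<open>l\<close> of
  \<open>T\<close> without changing the shadow.
\<close>

lemma same_shadow_exchange:
  assumes fin: "finite S" "finite T" and eq: "shadow f S = shadow f T"
    and less: "set_encode T < set_encode S"
  obtains l t where "l \<in> T - S" "t \<in> S - T" "f l = f t"
    "set_encode (insert l (S - {t})) < set_encode S"
proof -
  obtain t where t: "t \<in> S - T" and max: "\<And>p. p \<in> T - S \<Longrightarrow> p < t"
    using set_encode_less_max[OF fin less] by blast
  have "\<not> {p \<in> T. f p = f t} \<subseteq> {p \<in> S. f p = f t}"
  proof
    assume "{p \<in> T. f p = f t} \<subseteq> {p \<in> S. f p = f t}"
    then have "{p \<in> T. f p = f t} \<subset> {p \<in> S. f p = f t}" using t by blast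
    then have "card {p \<in> T. f p = f t} < card {p \<in> S. f p = f t}"
      using fin by (intro psubset_card_mono) auto
    then show False
      using eq lookup_shadow[OF fin(1), of f "f t"] lookup_shadow[OF fin(2), of f "f t"] by simp
  qed
  then obtain l where l: "l \<in> T - S" "f l = f t" by blast
  then have "l < t" using max by blast
  have "set_encode S = 2 ^ t + set_encode (S - {t})"
    using t fin(1) set_encode_insert[of "S - {t}" t] by (simp add: insert_absorb)
  moreover have "set_encode (insert l (S - {t})) = 2 ^ l + set_encode (S - {t})"
    using l fin(1) by (intro set_encode_insert) auto
  moreover have "(2::nat) ^ l < 2 ^ t" using \<open>l < t\<close> by simp
  ultimately show ?thesis using that l t by simp
qed

text \<open>
  A linear step between shadows lifts to any choice of preimages.
\<close>

lemma exchange_between_shadows: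
  assumes fin: "finite S" "finite T" and step: "linear_step E (shadow f S)"
    and "shadow f S \<notin> E" "shadow f T \<in> E"
  obtains l t where "l \<in> T - S" "t \<in> S" "shadow f (insert l (S - {t})) \<in> E"
proof -
  obtain b i j where b: "b \<in> E"
    and lt: "Poly_Mapping.lookup (shadow f S) i < Poly_Mapping.lookup (shadow f T) i"
    and eq: "b + Poly_Mapping.single j 1 = shadow f S + Poly_Mapping.single i 1"
    using step assms(5) unfolding linear_step_def by blast
  have "\<not> {p \<in> T. f p = i} \<subseteq> {p \<in> S. f p = i}"
    using lt card_mono[of "{p \<in> S. f p = i}" "{p \<in> T. f p = i}"] fin
    by (auto simp: lookup_shadow)
  then obtain l where l: "l \<in> T - S" "f l = i" by blast
  have "i \<noteq> j" using eq b assms(4) by auto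
  then have "Poly_Mapping.lookup (shadow f S) j \<noteq> 0"
    using arg_cong[OF eq, of "\<lambda>e. Poly_Mapping.lookup e j"]
    by (simp add: lookup_add lookup_single when_def)
  then have "{p \<in> S. f p = j} \<noteq> {}"
    by (simp only: lookup_shadow[OF fin(1)]) force
  then obtain t where t: "t \<in> S" "f t = j" by blast
  have "shadow f (insert l (S - {t})) + Poly_Mapping.single j 1 = b + Poly_Mapping.single j 1"
    using shadow_exchange[OF fin(1), of l t f] l t eq by simp
  then have "shadow f (insert l (S - {t})) = b" by simp
  with that l t b show ?thesis by blast
qed

text \<open>
  The subsets of \<open>X\<close> whose shadow belongs to \<open>E\<close>.
\<close>

definition shadow_preimage :: "(nat \<Rightarrow> nat) \<Rightarrow> nat set \<Rightarrow> (nat \<Rightarrow>\<^sub>0 nat) set \<Rightarrow> nat set set" where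
  "shadow_preimage f X E = {S. S \<subseteq> X \<and> shadow f S \<in> E}"

lemma extends_block:
  assumes X: "finite X" and step: "linear_step E u" and "u \<notin> E"
  shows "extends (indicator_exponent ` shadow_preimage f X E)
    (indicator_exponent ` shadow_preimage f X (insert u E))"
proof -
  have finX: "finite S" if "S \<subseteq> X" for S using X that by (rule rev_finite_subset)
  \<comment> \<open>The stages at which the preimages of \<open>u\<close> with code less than \<open>k\<close> are present. Each
    stage adds at most one set, since \<^const>\<open>set_encode\<close> is injective on finite sets.\<close>
  define F where "F k = shadow_preimage f X E \<union>
      {S \<in> shadow_preimage f X {u}. set_encode S < k}" for k
  have finF: "finite T" if "T \<in> F k" for T k
    using that finX by (auto simp: F_def shadow_preimage_def)
  have "extends (indicator_exponent ` shadow_preimage f X E) (indicator_exponent ` F k)" for k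
  proof (induction k)
    case 0
    show ?case by (simp add: F_def extends.start)
  next
    case (Suc k)
    show ?case
    proof (cases "\<exists>S \<in> shadow_preimage f X {u}. set_encode S = k")
      case False
      then have "F (Suc k) = F k" by (auto simp: F_def less_Suc_eq)
      with Suc show ?thesis by simp
    next
      case True
      then obtain S where S: "S \<subseteq> X" "shadow f S = u" "set_encode S = k"
        by (auto simp: shadow_preimage_def)
      have "set_encode S' = k \<longleftrightarrow> S' = S" if "S' \<subseteq> X" for S'
        using set_encode_eq[OF finX[OF that] finX[OF S(1)]] S(3) by simp
      then have "{S' \<in> shadow_preimage f X {u}. set_encode S' = k} = {S}"
        using S(1,2) unfolding shadow_preimage_def by blast
      then have F: "F (Suc k) = insert S (F k)"
        unfolding F_def less_Suc_eq by blast
      have notin: "S \<notin> F k"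
        using S \<open>u \<notin> E\<close> by (simp add: F_def shadow_preimage_def)
      have "\<exists>l \<in> T - S. \<exists>t \<in> S. insert l (S - {t}) \<in> F k" if T: "T \<in> F k" for T
      proof -
        have TX: "T \<subseteq> X" using T by (auto simp: F_def shadow_preimage_def)
        show ?thesis
        proof (cases "shadow f T \<in> E")
          case True
          obtain l t where "l \<in> T - S" "t \<in> S" "shadow f (insert l (S - {t})) \<in> E"
            using exchange_between_shadows[of S T E f] finX S TX step \<open>u \<notin> E\<close> True by metis
          moreover from this have "insert l (S - {t}) \<subseteq> X" using TX S by blast
          ultimately show ?thesis by (auto simp: F_def shadow_preimage_def)
        next
          case False
          then have "shadow f T = u" "set_encode T < k"
            using T by (auto simp: F_def shadow_preimage_def)
          then obtain l t where lt: "l \<in> T - S" "t \<in> S - T" "f l = f t"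
            "set_encode (insert l (S - {t})) < set_encode S"
            using same_shadow_exchange[of S T f] finX S TX by metis
          moreover have "insert l (S - {t}) \<subseteq> X" using lt TX S by blast
          moreover have "shadow f (insert l (S - {t})) = u"
            using shadow_exchange[of S l t f] finX S lt by simp
          ultimately have "insert l (S - {t}) \<in> F k"
            using S(3) by (simp add: F_def shadow_preimage_def)
          with lt show ?thesis by blast
        qed
      qed
      then have "linear_step (indicator_exponent ` F k) (indicator_exponent S)"
        by (simp add: linear_step_indicator_iff[OF finX[OF S(1)] finF notin])
      moreover have "indicator_exponent S \<notin> indicator_exponent ` F k"
      proof
        assume "indicator_exponent S \<in> indicator_exponent ` F k"
        then obtain T where "T \<in> F k" "indicator_exponent S = indicator_exponent T" by blast
        then show False using indicator_exponent_inj[OF finX[OF S(1)] finF] notin by blast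
      qed
      ultimately show ?thesis
        using extends.adjoin[OF Suc] by (simp add: F)
    qed
  qed
  moreover have "F (Suc (set_encode X)) = shadow_preimage f X (insert u E)"
  proof -
    have "set_encode S < Suc (set_encode X)" if "S \<subseteq> X" for S
      unfolding set_encode_def less_Suc_eq_le using X that by (rule sum_mono2) simp
    then show ?thesis unfolding F_def shadow_preimage_def by blast
  qed
  ultimately show ?thesis by metis
qed

lemma extends_preimage:
  assumes X: "finite X" and "extends {} E"
  shows "extends {} (indicator_exponent ` shadow_preimage f X E)"
  using assms(2)
proof (induction rule: extends.induct)
  case start
  show ?case by (simp add: shadow_preimage_def extends.start)
next
  case (adjoin E u)
  show ?case by (rule extends_trans[OF extends_block[OF X adjoin.hyps(3,2)] adjoin.IH])
qed

section \<open>The next monomial\<close>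

lemma exists_comparable_subset:
  assumes "finite Y" "S \<subseteq> Y" "k \<le> card Y"
  shows "\<exists>T \<subseteq> Y. card T = k \<and> (T \<subseteq> S \<or> S \<subseteq> T)"
proof (cases "k \<le> card S")
  case True
  then obtain T where "T \<subseteq> S" "card T = k" by (rule obtain_subset_with_card_n)
  then show ?thesis using assms(2) by blast
next
  case False
  then show ?thesis
    using exists_subset_between[of S k Y] assms by auto
qed

text \<open>
  If the fibres of \<open>f\<close> are large enough, then \<open>a\<close> is the shadow of a set \<open>T\<close> that is
  comparable with the given set \<open>S\<close> on each fibre.
\<close>

lemma exists_comparable_preimage:
  assumes X: "finite X" and S: "S \<subseteq> X"
    and a: "\<And>i. Poly_Mapping.lookup a i \<le> card {p \<in> X. f p = i}"
  shows "\<exists>T \<subseteq> X. shadow f T = a \<and>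
    (\<forall>i. {p \<in> T. f p = i} \<subseteq> {p \<in> S. f p = i} \<or> {p \<in> S. f p = i} \<subseteq> {p \<in> T. f p = i})"
proof -
  have "\<forall>i. \<exists>T \<subseteq> {p \<in> X. f p = i}. card T = Poly_Mapping.lookup a i \<and>
      (T \<subseteq> {p \<in> S. f p = i} \<or> {p \<in> S. f p = i} \<subseteq> T)"
    using X S by (intro allI exists_comparable_subset a) auto
  then obtain g where g: "\<And>i. g i \<subseteq> {p \<in> X. f p = i}" "\<And>i. card (g i) = Poly_Mapping.lookup a i"
    "\<And>i. g i \<subseteq> {p \<in> S. f p = i} \<or> {p \<in> S. f p = i} \<subseteq> g i"
    by metis
  define T where "T = (\<Union>i. g i)"
  have fib: "{p \<in> T. f p = i} = g i" for i
    using g(1) by (auto simp: T_def)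
  have TX: "T \<subseteq> X" using g(1) by (auto simp: T_def)
  then have "finite T" using X by (rule finite_subset)
  then have "shadow f T = a"
    by (intro poly_mapping_eqI) (simp add: lookup_shadow fib g(2))
  with TX g(3) fib show ?thesis by metis
qed

text \<open>
  The converse of the lifting: for a preimage \<open>T\<close> of \<open>a\<close> that is comparable with \<open>S\<close> on each
  fibre, an element of \<open>T - S\<close> over \<open>i\<close> forces the exponent of \<open>a\<close> at \<open>i\<close> to
  exceed that of the shadow of \<open>S\<close>.
\<close>

lemma linear_step_shadow:
  assumes X: "finite X" and SX: "S \<subseteq> X"
    and E: "\<And>a i. a \<in> E \<Longrightarrow> Poly_Mapping.lookup a i \<le> card {p \<in> X. f p = i}"
    and notin: "shadow f S \<notin> E"
    and step: "linear_step (indicator_exponent ` shadow_preimage f X E) (indicator_exponent S)"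
  shows "linear_step E (shadow f S)"
  unfolding linear_step_def
proof
  fix a assume a: "a \<in> E"
  have finX: "finite S" if "S \<subseteq> X" for S using X that by (rule rev_finite_subset)
  obtain T where T: "T \<subseteq> X" "shadow f T = a"
    and comp: "\<And>i. {p \<in> T. f p = i} \<subseteq> {p \<in> S. f p = i} \<or> {p \<in> S. f p = i} \<subseteq> {p \<in> T. f p = i}"
    using exists_comparable_preimage[OF X SX, of a f] E[OF a] by blast
  have "T \<in> shadow_preimage f X E" using T a by (simp add: shadow_preimage_def)
  moreover have "\<forall>T \<in> shadow_preimage f X E. \<exists>l \<in> T - S. \<exists>t \<in> S.
      insert l (S - {t}) \<in> shadow_preimage f X E"
    using step finX SX notin linear_step_indicator_iff[of S "shadow_preimage f X E"]
    by (auto simp: shadow_preimage_def)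
  ultimately obtain l t where l: "l \<in> T - S" and t: "t \<in> S"
    and B: "shadow f (insert l (S - {t})) \<in> E"
    by (auto simp: shadow_preimage_def)
  have "{p \<in> S. f p = f l} \<subset> {p \<in> T. f p = f l}"
    using comp[of "f l"] l by blast
  then have "card {p \<in> S. f p = f l} < card {p \<in> T. f p = f l}"
    using finX[OF T(1)] by (intro psubset_card_mono) auto
  then have "Poly_Mapping.lookup (shadow f S) (f l) < Poly_Mapping.lookup a (f l)"
    using lookup_shadow[OF finX[OF SX], of f "f l"] lookup_shadow[OF finX[OF T(1)], of f "f l"]
    by (simp add: T(2))
  moreover have "shadow f (insert l (S - {t})) + Poly_Mapping.single (f t) 1 =
      shadow f S + Poly_Mapping.single (f l) 1"
    using shadow_exchange[of S l t f] finX[OF SX] l t by simp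
  ultimately show "\<exists>b \<in> E. \<exists>l t. Poly_Mapping.lookup (shadow f S) l < Poly_Mapping.lookup a l \<and>
      b + Poly_Mapping.single t 1 = shadow f S + Poly_Mapping.single l 1"
    using B by blast
qed

text \<open>
  The variable \<open>x\<^sub>i\<close> has the \<open>d\<close> copies with indices
  \<open>(i - 1) d + 1, \<dots>, i d\<close>. As no exponent in degree \<open>d\<close> exceeds \<open>d\<close>, this is
  enough for every monomial of degree \<open>d\<close> to be a shadow.
\<close>

definition copy_of :: "nat \<Rightarrow> nat \<Rightarrow> nat" where
  "copy_of d p = (p - 1) div d + 1"

lemma copy_of_range:
  assumes "p \<in> {1..n * d}"
  shows "copy_of d p \<in> {1..n}"
proof -
  have "p - 1 < n * d" using assms by auto
  then have "(p - 1) div d < n" by (simp add: less_mult_imp_div_less)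
  then show ?thesis by (simp add: copy_of_def)
qed

lemma card_copies:
  assumes "1 \<le> d" "i \<in> {1..n}"
  shows "card {p \<in> {1..n * d}. copy_of d p = i} = d"
proof -
  obtain j where j: "i = Suc j" "j < n" using assms(2) by (cases i) auto
  have le: "Suc j * d \<le> n * d" using j by (intro mult_le_mono1) simp
  have "{p \<in> {1..n * d}. copy_of d p = i} = {j * d + 1..j * d + d}"
  proof (rule equalityI; rule subsetI)
    fix p assume p: "p \<in> {p \<in> {1..n * d}. copy_of d p = i}"
    then have "(p - 1) div d = j" by (simp add: copy_of_def j)
    then have "j * d \<le> p - 1" "p - 1 < j * d + d"
      using assms(1) div_times_less_eq_dividend[of "p - 1" d] dividend_less_div_times[of d "p - 1"]
      by auto
    then show "p \<in> {j * d + 1..j * d + d}" using p by auto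
  next
    fix p assume p: "p \<in> {j * d + 1..j * d + d}"
    then have "(p - 1) div d = j"
      using assms(1) by (intro div_nat_eqI) (auto simp: algebra_simps)
    then show "p \<in> {p \<in> {1..n * d}. copy_of d p = i}"
      using p le by (auto simp: copy_of_def j)
  qed
  then show ?thesis by simp
qed

lemma shadow_in_exponents:
  assumes S: "S \<subseteq> {1..n * d}"
  shows "shadow (copy_of d) S \<in> exponents n (card S)"
proof -
  have fin: "finite S" using S by (rule finite_subset) simp
  have range: "copy_of d p \<in> {1..n}" if "p \<in> S" for p
    using S that copy_of_range by blast
  have "Poly_Mapping.keys (shadow (copy_of d) S) \<subseteq> {1..n}"
  proof
    fix i assume "i \<in> Poly_Mapping.keys (shadow (copy_of d) S)"
    then have "{p \<in> S. copy_of d p = i} \<noteq> {}"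
      by (simp add: in_keys_iff lookup_shadow fin)
    with range show "i \<in> {1..n}" by blast
  qed
  moreover have "(\<Sum>i = 1..n. card {p \<in> S. copy_of d p = i}) = card S"
    using sum.group[OF fin, of "{1..n}" "copy_of d" "\<lambda>_. 1::nat"] range by (auto simp: image_subset_iff)
  ultimately show ?thesis by (simp add: exponents_def lookup_shadow fin)
qed

lemma exists_next_exponent:
  assumes "1 \<le> d"
    and ext: "\<And>F. F \<subseteq> squarefree_exponents (n * d) d \<Longrightarrow> extends {} F \<Longrightarrow>
      extends F (squarefree_exponents (n * d) d)"
    and E: "E \<subset> exponents n d" "extends {} E"
  shows "\<exists>w \<in> exponents n d - E. linear_step E w"
proof -
  let ?X = "{1..n * d}" and ?f = "copy_of d"
  let ?F = "indicator_exponent ` shadow_preimage ?f ?X E"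
  have card: "Poly_Mapping.lookup a i \<le> card {p \<in> ?X. ?f p = i}"
    if "a \<in> exponents n d" for a i
  proof (cases "i \<in> {1..n}")
    case True
    then show ?thesis
      using card_copies[OF \<open>1 \<le> d\<close> True] that member_le_sum[of i "{1..n}" "Poly_Mapping.lookup a"]
      by (simp add: exponents_def)
  next
    case False
    then have "Poly_Mapping.lookup a i = 0"
      using that by (auto simp: exponents_def in_keys_iff)
    then show ?thesis by simp
  qed
  have degree: "shadow ?f S \<in> exponents n d \<longleftrightarrow> card S = d" if "S \<subseteq> ?X" for S
    using shadow_in_exponents[OF that] by (auto simp: exponents_def)
  have sub: "?F \<subseteq> squarefree_exponents (n * d) d"
    unfolding squarefree_exponents_eq using E(1) degree by (auto simp: shadow_preimage_def)
  have fin: "finite S" if "S \<subseteq> ?X" for S using that by (rule finite_subset) simp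
  have "extends {} ?F" using E(2) by (intro extends_preimage) auto
  then have extF: "extends ?F (squarefree_exponents (n * d) d)" using ext sub by blast
  \<comment> \<open>The extension is nontrivial, as a preimage of a missing monomial is missing.\<close>
  obtain w where w: "w \<in> exponents n d" "w \<notin> E" using E(1) by blast
  obtain W where W: "W \<subseteq> ?X" "shadow ?f W = w"
    using exists_comparable_preimage[of ?X "{}" w ?f] card[OF w(1)] by auto
  have "indicator_exponent W \<notin> ?F"
  proof
    assume "indicator_exponent W \<in> ?F"
    then obtain S where "S \<subseteq> ?X" "shadow ?f S \<in> E" "indicator_exponent W = indicator_exponent S"
      by (auto simp: shadow_preimage_def)
    then show False using indicator_exponent_inj[of W S] fin W w(2) by auto
  qed
  moreover have "indicator_exponent W \<in> squarefree_exponents (n * d) d"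
    unfolding squarefree_exponents_eq using W w(1) degree by blast
  ultimately have "?F \<noteq> squarefree_exponents (n * d) d" by blast
  with extends_first_step[OF extF] obtain S where S: "S \<subseteq> ?X" "card S = d"
    "indicator_exponent S \<notin> ?F" "linear_step ?F (indicator_exponent S)"
    unfolding squarefree_exponents_eq by blast
  have notin: "shadow ?f S \<notin> E" using S by (auto simp: shadow_preimage_def)
  have "linear_step E (shadow ?f S)"
  proof (rule linear_step_shadow[OF _ S(1) _ notin S(4)])
    show "Poly_Mapping.lookup a i \<le> card {p \<in> ?X. ?f p = i}" if "a \<in> E" for a i
      using card[of a i] that E(1) by blast
  qed simp
  moreover have "shadow ?f S \<in> exponents n d" using degree[OF S(1)] S(2) by simp
  ultimately show ?thesis using notin by blast
qed

lemma extends_exponents: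
  assumes "1 \<le> d"
    and ext: "\<And>F. F \<subseteq> squarefree_exponents (n * d) d \<Longrightarrow> extends {} F \<Longrightarrow>
      extends F (squarefree_exponents (n * d) d)"
    and "E \<subseteq> exponents n d" "extends {} E"
  shows "extends E (exponents n d)"
  using assms(3,4)
proof (induction "card (exponents n d - E)" arbitrary: E rule: less_induct)
  case less
  show ?case
  proof (cases "E = exponents n d")
    case True
    then show ?thesis by (simp add: extends.start)
  next
    case False
    then obtain w where w: "w \<in> exponents n d" "w \<notin> E" "linear_step E w"
      using exists_next_exponent[OF assms(1) ext, of E] less.prems by blast
    have "card (exponents n d - insert w E) < card (exponents n d - E)"
      using w finite_exponents by (intro psubset_card_mono) auto
    moreover have "extends {} (insert w E)" using less.prems w by (intro extends.adjoin)
    ultimately have "extends (insert w E) (exponents n d)"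
      using less.hyps less.prems w by blast
    moreover have "extends E (insert w E)" using w by (intro extends.adjoin extends.start)
    ultimately show ?thesis by (rule extends_trans)
  qed
qed

section \<open>Colon ideals generated by variables\<close>

lemma keys_times_monomial:
  "Poly_Mapping.keys (f * monomial_of u :: 'k::field mpoly) = (\<lambda>e. e + u) ` Poly_Mapping.keys f"
proof -
  have "f * monomial_of u =
      (\<Sum>e \<in> Poly_Mapping.keys f. Poly_Mapping.single (e + u) (Poly_Mapping.lookup f e))"
    by (subst (1) poly_sum_singles) (simp add: monomial_of_def sum_distrib_right mult_single)
  then have "Poly_Mapping.lookup (f * monomial_of u) (e + u) = Poly_Mapping.lookup f e" for e
    by (simp add: lookup_sum lookup_single when_def in_keys_iff)
  moreover have "Poly_Mapping.keys (f * monomial_of u) \<subseteq> (\<lambda>e. e + u) ` Poly_Mapping.keys f"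
    using keys_mult[of f "monomial_of u"] by (auto simp: monomial_of_def)
  ultimately show ?thesis by (auto simp: in_keys_iff)
qed

lemma colon_exponents_upward_closed:
  "(\<exists>b \<in> {e. \<exists>a \<in> E. \<exists>c. e + u = a + c}. \<exists>c. e = b + c) \<longleftrightarrow>
     (\<exists>a \<in> E. \<exists>c. e + u = a + (c :: nat \<Rightarrow>\<^sub>0 nat))"
proof
  assume "\<exists>b \<in> {e. \<exists>a \<in> E. \<exists>c. e + u = a + c}. \<exists>c. e = b + c"
  then obtain a b c d where "a \<in> E" "b + u = a + d" "e = b + c" by blast
  then have "e + u = a + (d + c)" by (metis add.assoc add.commute)
  with \<open>a \<in> E\<close> show "\<exists>a \<in> E. \<exists>c. e + u = a + c" by blast
next
  assume "\<exists>a \<in> E. \<exists>c. e + u = a + c"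
  then show "\<exists>b \<in> {e. \<exists>a \<in> E. \<exists>c. e + u = a + c}. \<exists>c. e = b + c"
    by (intro bexI[of _ e] exI[of _ 0]) simp_all
qed

lemma colon_ideal_span_of:
  assumes "Poly_Mapping.keys u \<subseteq> {1..n}"
  shows "colon_ideal n (span_of n E :: 'k::field mpoly set) (monomial_of u) =
    span_of n {e. \<exists>a \<in> E. \<exists>c. e + u = a + c}"
  using assms unfolding span_of_def colon_exponents_upward_closed
  by (auto simp: colon_ideal_def keys_times_monomial keys_add_nat)

lemma span_of_eq_iff:
  fixes E F :: "(nat \<Rightarrow>\<^sub>0 nat) set"
  shows
  "(span_of n E :: 'k::field mpoly set) = span_of n F \<longleftrightarrow>
     (\<forall>e. Poly_Mapping.keys e \<subseteq> {1..n} \<longrightarrow>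
       (\<exists>a \<in> E. \<exists>c. e = a + c) = (\<exists>a \<in> F. \<exists>c. e = a + c))"
    (is "_ \<longleftrightarrow> ?R")
proof
  assume eq: "(span_of n E :: 'k mpoly set) = span_of n F"
  show ?R
  proof (intro allI impI)
    fix e :: "nat \<Rightarrow>\<^sub>0 nat"
    assume "Poly_Mapping.keys e \<subseteq> {1..n}"
    then show "(\<exists>a \<in> E. \<exists>c. e = a + c) = (\<exists>a \<in> F. \<exists>c. e = a + c)"
      using monomial_of_in_span_of[of e n E, where 'a = 'k]
        monomial_of_in_span_of[of e n F, where 'a = 'k] eq by simp
  qed
next
  assume ?R
  then show "(span_of n E :: 'k mpoly set) = span_of n F"
    by (auto simp: span_of_def)
qed

lemma generated_by_variables_span_of:
  "generated_by_variables n (span_of n E :: 'k::field mpoly set) \<longleftrightarrow>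
     (\<exists>L \<subseteq> {1..n}. \<forall>e. Poly_Mapping.keys e \<subseteq> {1..n} \<longrightarrow>
       (\<exists>a \<in> E. \<exists>c. e = a + c) = (\<exists>l \<in> L. Poly_Mapping.lookup e l \<noteq> 0))"
proof -
  let ?x = "\<lambda>i. Poly_Mapping.single i (1::nat)"
  have vars: "(variables n :: 'k mpoly set) = (\<lambda>i. monomial_of (?x i)) ` {1..n}"
    by (simp add: variables_def monomial_of_def)
  have "Idl\<^bsub>mpoly_ring n\<^esub> ((\<lambda>i. monomial_of (?x i)) ` L) =
      (span_of n (?x ` L) :: 'k mpoly set)" if "L \<subseteq> {1..n}" for L
  proof -
    have "Idl\<^bsub>mpoly_ring n\<^esub> (monomial_of ` ?x ` L) = (span_of n (?x ` L) :: 'k mpoly set)"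
      using that by (intro Idl_monomials) auto
    then show ?thesis by (simp add: image_image)
  qed
  moreover have "(\<exists>c. e = ?x l + c) \<longleftrightarrow> Poly_Mapping.lookup e l \<noteq> 0"
    for e :: "nat \<Rightarrow>\<^sub>0 nat" and l
    unfolding ex_add_iff by (auto simp: lookup_single when_def Suc_le_eq)
  then have "(\<exists>a \<in> ?x ` L. \<exists>c. e = a + c) \<longleftrightarrow> (\<exists>l \<in> L. Poly_Mapping.lookup e l \<noteq> 0)"
    for e :: "nat \<Rightarrow>\<^sub>0 nat" and L
    by simp
  moreover have "generated_by_variables n (span_of n E :: 'k mpoly set) \<longleftrightarrow>
      (\<exists>L \<subseteq> {1..n}. span_of n E =
        (Idl\<^bsub>mpoly_ring n\<^esub> ((\<lambda>i. monomial_of (?x i)) ` L) :: 'k mpoly set))"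
    unfolding generated_by_variables_def vars subset_image_iff by blast
  ultimately show ?thesis
    by (simp add: span_of_eq_iff del: One_nat_def cong: conj_cong)
qed

text \<open>
  If the colon ideal is generated by variables, then \<open>x\<^sup>a / gcd(x\<^sup>a, x\<^sup>u)\<close> is
  divisible by some \<open>x\<^sub>l\<close> in it; \<open>u x\<^sub>l\<close> is then a multiple of a generator, the cofactor
  having degree one. Conversely, the variables in the colon ideal generate it.
\<close>

lemma generated_by_variables_iff_linear_step:
  assumes E: "E \<subseteq> exponents n d" and u: "u \<in> exponents n d"
  shows "generated_by_variables n
      (colon_ideal n (span_of n E :: 'k::field mpoly set) (monomial_of u)) \<longleftrightarrow> linear_step E u"
proof -
  define P where "P e \<longleftrightarrow> (\<exists>a \<in> E. \<exists>c. e + u = a + c)" for e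
  let ?x = "\<lambda>i. Poly_Mapping.single i (1::nat)"
  have upward: "(\<exists>b \<in> {e. P e}. \<exists>c. e = b + c) \<longleftrightarrow> P e" for e
    unfolding P_def by (rule colon_exponents_upward_closed)
  have "generated_by_variables n
      (colon_ideal n (span_of n E :: 'k mpoly set) (monomial_of u)) \<longleftrightarrow>
    (\<exists>L \<subseteq> {1..n}. \<forall>e. Poly_Mapping.keys e \<subseteq> {1..n} \<longrightarrow>
      P e = (\<exists>l \<in> L. Poly_Mapping.lookup e l \<noteq> 0))"
    unfolding colon_ideal_span_of[OF exponents_keys[OF u]] P_def[symmetric]
      generated_by_variables_span_of upward ..
  also have "\<dots> \<longleftrightarrow> linear_step E u"
  proof
    assume "\<exists>L \<subseteq> {1..n}. \<forall>e. Poly_Mapping.keys e \<subseteq> {1..n} \<longrightarrow>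
      P e = (\<exists>l \<in> L. Poly_Mapping.lookup e l \<noteq> 0)"
    then obtain L where L: "L \<subseteq> {1..n}" and PL: "\<And>e. Poly_Mapping.keys e \<subseteq> {1..n} \<Longrightarrow>
      P e \<longleftrightarrow> (\<exists>l \<in> L. Poly_Mapping.lookup e l \<noteq> 0)" by blast
    show "linear_step E u"
      unfolding linear_step_def
    proof
      fix a assume a: "a \<in> E"
      then have keys_a: "Poly_Mapping.keys a \<subseteq> {1..n}" using E exponents_keys by blast
      \<comment> \<open>\<open>a - u\<close> is the exponent of \<open>x\<^sup>a / gcd(x\<^sup>a, x\<^sup>u)\<close>.\<close>
      have "a - u + u = a + (u - a)"
        by (rule poly_mapping_eqI) (simp add: lookup_add lookup_minus)
      then have "P (a - u)" unfolding P_def using a by blast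
      moreover have "Poly_Mapping.keys (a - u) \<subseteq> {1..n}"
        using keys_a by (auto simp: in_keys_iff lookup_minus)
      ultimately obtain l where l: "l \<in> L" "Poly_Mapping.lookup u l < Poly_Mapping.lookup a l"
        using PL by (auto simp: lookup_minus)
      have "Poly_Mapping.lookup (?x l) l \<noteq> 0" "Poly_Mapping.keys (?x l) \<subseteq> {1..n}"
        using l(1) L by auto
      then have "P (?x l)" using PL l(1) by blast
      then obtain b c where b: "b \<in> E" and eq: "u + ?x l = b + c"
        unfolding P_def by (metis add.commute)
      have "Poly_Mapping.keys (u + ?x l) \<subseteq> {1..n}"
        using u l(1) L by (auto simp: keys_add_nat exponents_def)
      then have "Poly_Mapping.keys c \<subseteq> {1..n}"
        unfolding eq keys_add_nat by blast
      moreover have "(\<Sum>i = 1..n. Poly_Mapping.lookup c i) = 1"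
      proof -
        have "(\<Sum>i = 1..n. Poly_Mapping.lookup (?x l) i) = 1"
          using l(1) L by (intro sum_lookup_single) auto
        moreover have "(\<Sum>i = 1..n. Poly_Mapping.lookup (u + ?x l) i) =
            (\<Sum>i = 1..n. Poly_Mapping.lookup (b + c) i)"
          by (simp only: eq)
        ultimately show ?thesis
          using u b E by (auto simp: sum_lookup_add exponents_def)
      qed
      ultimately obtain t where "c = ?x t" using degree_one_exponent by blast
      with b eq l(2) show "\<exists>b \<in> E. \<exists>l t. Poly_Mapping.lookup u l < Poly_Mapping.lookup a l \<and>
          b + ?x t = u + ?x l"
        by metis
    qed
  next
    assume step: "linear_step E u"
    define L where "L = {l \<in> {1..n}. P (?x l)}"
    have "P e \<longleftrightarrow> (\<exists>l \<in> L. Poly_Mapping.lookup e l \<noteq> 0)"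
      if e: "Poly_Mapping.keys e \<subseteq> {1..n}" for e
    proof
      assume "P e"
      then obtain a c where a: "a \<in> E" "e + u = a + c" unfolding P_def by blast
      then obtain b l t where b: "b \<in> E" "Poly_Mapping.lookup u l < Poly_Mapping.lookup a l"
        "b + ?x t = u + ?x l"
        using step unfolding linear_step_def by blast
      have "Poly_Mapping.lookup e l \<noteq> 0"
        using arg_cong[OF a(2), of "\<lambda>e. Poly_Mapping.lookup e l"] b(2) by (simp add: lookup_add)
      moreover from this have "l \<in> {1..n}" using e subsetD[OF e, of l] by (simp add: in_keys_iff)
      moreover have "?x l + u = b + ?x t" using b(3) by (simp add: add.commute)
      then have "P (?x l)" unfolding P_def using b(1) by blast
      ultimately show "\<exists>l \<in> L. Poly_Mapping.lookup e l \<noteq> 0" unfolding L_def by blast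
    next
      assume "\<exists>l \<in> L. Poly_Mapping.lookup e l \<noteq> 0"
      then obtain l where l: "P (?x l)" "Poly_Mapping.lookup e l \<noteq> 0" unfolding L_def by blast
      then have "\<exists>c. e = ?x l + c"
        by (auto simp: ex_add_iff lookup_single when_def)
      with l(1) upward[of e] show "P e" by blast
    qed
    then show "\<exists>L \<subseteq> {1..n}. \<forall>e. Poly_Mapping.keys e \<subseteq> {1..n} \<longrightarrow>
        P e = (\<exists>l \<in> L. Poly_Mapping.lookup e l \<noteq> 0)"
      by (intro exI[of _ L]) (auto simp: L_def)
  qed
  finally show ?thesis .
qed

section \<open>Equigenerated monomial ideals\<close>

lemma min_exponents_equigenerated:
  assumes "E \<subseteq> exponents n d"
  shows "min_exponents E = E"
proof -
  have "c = 0" if "a \<in> E" "a + c \<in> E" for a c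
  proof -
    have "a \<in> exponents n d" "a + c \<in> exponents n d" using that assms by blast+
    then have "(\<Sum>i = 1..n. Poly_Mapping.lookup c i) = 0" "Poly_Mapping.keys c \<subseteq> {1..n}"
      unfolding exponents_def by (simp_all add: sum_lookup_add keys_add_nat del: sum_eq_0_iff)
    then have "Poly_Mapping.lookup c i = 0" for i
      by (cases "i \<in> {1..n}") (auto simp: in_keys_iff)
    then show ?thesis by (intro poly_mapping_eqI) simp
  qed
  then show ?thesis by (auto simp: min_exponents_def)
qed

lemma Idl_exponents:
  assumes "E \<subseteq> exponents n d"
  shows "Idl\<^bsub>mpoly_ring n\<^esub> (monomial_of ` E) = (span_of n E :: 'k::field mpoly set)"
  using assms exponents_keys by (intro Idl_monomials) blast

lemma monomial_ideal_Idl: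
  assumes "E \<subseteq> exponents n d"
  shows "monomial_ideal n (Idl\<^bsub>mpoly_ring n\<^esub> (monomial_of ` E) :: 'k::field mpoly set)"
  unfolding monomial_ideal_def
proof (intro exI conjI)
  show "(monomial_of ` E :: 'k mpoly set) \<subseteq> monomials n"
    using assms exponents_keys unfolding monomials_def by blast
qed simp

lemma min_gens_Idl:
  assumes "E \<subseteq> exponents n d"
  shows "min_gens n (Idl\<^bsub>mpoly_ring n\<^esub> (monomial_of ` E) :: 'k::field mpoly set) = monomial_of ` E"
proof -
  have "min_monomial_generating_set n (Idl\<^bsub>mpoly_ring n\<^esub> (monomial_of ` E) :: 'k mpoly set) A \<longleftrightarrow>
      A = monomial_of ` min_exponents E" for A
    using assms exponents_keys by (intro min_monomial_generating_set_iff) blast+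
  then show ?thesis
    unfolding min_gens_def min_exponents_equigenerated[OF assms] by (intro the_equality) simp_all
qed

lemma monomial_ideal_with_min_gens_subset:
  fixes I :: "'k::field mpoly set"
  assumes "monomial_ideal n I" "min_gens n I \<subseteq> monomial_of ` F"
  obtains E where "E \<subseteq> F" "I = Idl\<^bsub>mpoly_ring n\<^esub> (monomial_of ` E)"
proof -
  obtain A where A: "A \<subseteq> monomials n" "I = Idl\<^bsub>mpoly_ring n\<^esub> A"
    using assms(1) by (auto simp: monomial_ideal_def)
  obtain E where E: "A = monomial_of ` E" "\<And>e. e \<in> E \<Longrightarrow> Poly_Mapping.keys e \<subseteq> {1..n}"
    using subset_monomialsE[OF A(1)] by blast
  have iff: "min_monomial_generating_set n I B \<longleftrightarrow> B = monomial_of ` min_exponents E" for B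
    using min_monomial_generating_set_iff[OF E(2)] A(2) E(1) by blast
  then have "min_gens n I = monomial_of ` min_exponents E"
    unfolding min_gens_def by (intro the_equality) simp_all
  then have "min_exponents E \<subseteq> F"
    using assms(2) by (simp add: inj_image_subset_iff[OF inj_monomial_of])
  moreover have "I = Idl\<^bsub>mpoly_ring n\<^esub> (monomial_of ` min_exponents E)"
    using iff unfolding min_monomial_generating_set_def by blast
  ultimately show ?thesis by (rule that)
qed

text \<open>
  Orderings of a set of monomials correspond to orderings of the set of exponents.
\<close>

lemma ex_monomial_list_iff:
  "(\<exists>us. distinct us \<and> set us = (monomial_of ` F :: 'k::field mpoly set) \<and> P us) \<longleftrightarrow>
     (\<exists>ws. distinct ws \<and> set ws = F \<and> P (map monomial_of ws))"
proof
  assume "\<exists>us. distinct us \<and> set us = (monomial_of ` F :: 'k mpoly set) \<and> P us"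
  then obtain us where us: "distinct us" "set us = (monomial_of ` F :: 'k mpoly set)" "P us"
    by blast
  have "us \<in> lists (range monomial_of)" using us(2) by auto
  then obtain ws where ws: "us = map monomial_of ws" by (auto simp: lists_image)
  with us have "distinct ws" "set ws = F" "P (map monomial_of ws)"
    by (auto simp: distinct_map inj_image_eq_iff[OF inj_monomial_of])
  then show "\<exists>ws. distinct ws \<and> set ws = F \<and> P (map monomial_of ws)" by blast
next
  assume "\<exists>ws. distinct ws \<and> set ws = F \<and> P (map monomial_of ws)"
  then obtain ws where "distinct ws" "set ws = F" "P (map monomial_of ws)" by blast
  then show "\<exists>us. distinct us \<and> set us = (monomial_of ` F :: 'k mpoly set) \<and> P us"
    using inj_on_subset[OF inj_monomial_of subset_UNIV]
    by (intro exI[of _ "map monomial_of ws"]) (simp add: distinct_map)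
qed

lemma has_linear_quotients_iff_extends:
  assumes E: "E \<subseteq> exponents n d"
  shows "has_linear_quotients n (Idl\<^bsub>mpoly_ring n\<^esub> (monomial_of ` E) :: 'k::field mpoly set) \<longleftrightarrow>
    extends {} E"
proof -
  have colon: "generated_by_variables n (colon_ideal n (Idl\<^bsub>mpoly_ring n\<^esub>
        (set (take j (map monomial_of ws)) :: 'k mpoly set)) (monomial_of (ws ! j))) \<longleftrightarrow>
      linear_step (set (take j ws)) (ws ! j)" if "set ws = E" "j < length ws" for ws j
  proof -
    have sub: "set (take j ws) \<subseteq> exponents n d" "ws ! j \<in> exponents n d"
      using that E set_take_subset[of j ws] nth_mem by blast+
    show ?thesis
      using generated_by_variables_iff_linear_step[OF sub, where 'k = 'k] that(2)
      by (simp add: take_map Idl_exponents[OF sub(1)])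
  qed
  \<comment> \<open>The position \<open>j = 0\<close>, excluded for linear quotients, imposes no condition.\<close>
  have "linear_step (set (take 0 ws)) u" for ws u by (simp add: linear_step_def)
  then have "(\<forall>j. 1 \<le> j \<and> j < length ws \<longrightarrow> linear_step (set (take j ws)) (ws ! j)) \<longleftrightarrow>
      (\<forall>j < length ws. linear_step (set (take j ws)) (ws ! j))" for ws
    by (metis One_nat_def Suc_leI neq0_conv)
  then show ?thesis
    unfolding has_linear_quotients_def min_gens_Idl[OF E] ex_monomial_list_iff extends_iff_list
    by (simp add: colon cong: conj_cong)
qed

lemma Idl_Idl_Un:
  assumes "X \<subseteq> carrier (mpoly_ring n)" "Y \<subseteq> carrier (mpoly_ring n)"
  shows "Idl\<^bsub>mpoly_ring n\<^esub> (Idl\<^bsub>mpoly_ring n\<^esub> X \<union> Y) =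
    (Idl\<^bsub>mpoly_ring n\<^esub> (X \<union> Y) :: 'k::field mpoly set)"
proof -
  interpret cring "mpoly_ring n :: 'k mpoly ring" by (rule cring_mpoly_ring)
  have XY: "X \<union> Y \<subseteq> carrier (mpoly_ring n)" using assms by blast
  have carrier: "Idl\<^bsub>mpoly_ring n\<^esub> X \<union> Y \<subseteq> carrier (mpoly_ring n)"
    using ideal.Icarr[OF genideal_ideal[OF assms(1)]] assms(2) by blast
  show ?thesis
  proof
    show "Idl\<^bsub>mpoly_ring n\<^esub> (Idl\<^bsub>mpoly_ring n\<^esub> X \<union> Y) \<subseteq> Idl\<^bsub>mpoly_ring n\<^esub> (X \<union> Y)"
      using genideal_self[OF XY]
      by (intro genideal_minimal genideal_ideal XY Un_least) blast+
    show "Idl\<^bsub>mpoly_ring n\<^esub> (X \<union> Y) \<subseteq> Idl\<^bsub>mpoly_ring n\<^esub> (Idl\<^bsub>mpoly_ring n\<^esub> X \<union> Y)"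
      using genideal_self[OF carrier] genideal_self[OF assms(1)]
      by (intro genideal_minimal genideal_ideal carrier) blast
  qed
qed

lemma extendable_iff_extends:
  assumes EF: "E \<subseteq> F" and F: "F \<subseteq> exponents n d"
  shows "extendable_by_linear_quotients n
      (Idl\<^bsub>mpoly_ring n\<^esub> (monomial_of ` E) :: 'k::field mpoly set)
      (Idl\<^bsub>mpoly_ring n\<^esub> (monomial_of ` F)) \<longleftrightarrow> extends E F"
proof -
  interpret cring "mpoly_ring n :: 'k mpoly ring" by (rule cring_mpoly_ring)
  have E: "E \<subseteq> exponents n d" using EF F by blast
  have carrier: "(monomial_of ` G :: 'k mpoly set) \<subseteq> carrier (mpoly_ring n)"
    if "G \<subseteq> exponents n d" for G
    using that exponents_keys monomial_of_carrier by blast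
  have colon: "generated_by_variables n (colon_ideal n (Idl\<^bsub>mpoly_ring n\<^esub>
        (Idl\<^bsub>mpoly_ring n\<^esub> (monomial_of ` E) \<union> set (take j (map monomial_of ws)) :: 'k mpoly set))
          (monomial_of (ws ! j))) \<longleftrightarrow>
      linear_step (E \<union> set (take j ws)) (ws ! j)" if "set ws = F - E" "j < length ws" for ws j
  proof -
    have ws: "set (take j ws) \<subseteq> exponents n d" "ws ! j \<in> exponents n d"
      using that F set_take_subset[of j ws] nth_mem by blast+
    then have sub: "E \<union> set (take j ws) \<subseteq> exponents n d" using E by blast
    show ?thesis
      using generated_by_variables_iff_linear_step[OF sub ws(2), where 'k = 'k] that(2)
        Idl_Idl_Un[OF carrier[OF E] carrier[OF ws(1)]] Idl_exponents[OF sub, where 'k = 'k]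
      by (simp add: take_map image_Un)
  qed
  have "Idl\<^bsub>mpoly_ring n\<^esub> (monomial_of ` E) \<subseteq> (Idl\<^bsub>mpoly_ring n\<^esub> (monomial_of ` F) :: 'k mpoly set)"
    using EF genideal_self[OF carrier[OF F]]
    by (intro genideal_minimal genideal_ideal carrier F) blast
  moreover have "(monomial_of ` F - monomial_of ` E :: 'k mpoly set) = monomial_of ` (F - E)"
    by (simp add: image_set_diff[OF inj_monomial_of])
  ultimately show ?thesis
    using EF unfolding extendable_by_linear_quotients_def min_gens_Idl[OF E] min_gens_Idl[OF F]
      extends_iff_list
    by (simp add: ex_monomial_list_iff colon monomial_ideal_Idl[OF E] monomial_ideal_Idl[OF F]
        image_mono cong: conj_cong)
qed

section \<open>The two ambient ideals\<close>

lemma squarefree_veronese_ideal_eq: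
  "squarefree_veronese_ideal n d =
     (Idl\<^bsub>mpoly_ring n\<^esub> (monomial_of ` squarefree_exponents n d) :: 'k::field mpoly set)"
proof -
  have "squarefree_monomials_of_degree n d =
      (monomial_of ` squarefree_exponents n d :: 'k mpoly set)"
    by (auto simp: squarefree_monomials_of_degree_def squarefree_exponents_def exponents_def)
  then show ?thesis by (simp add: squarefree_veronese_ideal_def)
qed

lemma exponents_Suc:
  assumes "e \<in> exponents n (Suc d)"
  obtains a i where "a \<in> exponents n d" "i \<in> {1..n}" "e = a + Poly_Mapping.single i 1"
proof -
  have "(\<Sum>i = 1..n. Poly_Mapping.lookup e i) \<noteq> 0" using assms by (simp add: exponents_def)
  then obtain i where i: "i \<in> {1..n}" "Poly_Mapping.lookup e i \<noteq> 0"
    by (meson sum.neutral)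
  then have "\<exists>c. e = Poly_Mapping.single i 1 + c"
    by (auto simp: ex_add_iff lookup_single when_def)
  then obtain a where a: "e = a + Poly_Mapping.single i 1" by (metis add.commute)
  have "(\<Sum>j = 1..n. Poly_Mapping.lookup (Poly_Mapping.single i (1::nat)) j) = 1"
    using i(1) by (intro sum_lookup_single) auto
  then have "a \<in> exponents n d"
    using assms by (simp add: a exponents_def keys_add_nat sum_lookup_add)
  with i(1) a that show ?thesis by blast
qed

lemma single_in_exponents:
  "i \<in> {1..n} \<Longrightarrow> a \<in> exponents n d \<Longrightarrow> a + Poly_Mapping.single i 1 \<in> exponents n (Suc d)"
  by (auto simp: exponents_def keys_add_nat sum_lookup_add sum_lookup_single)

lemma max_ideal_power_eq:
  "max_ideal_power n d =
     (Idl\<^bsub>mpoly_ring n\<^esub> (monomial_of ` exponents n d) :: 'k::field mpoly set)"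
proof -
  interpret cring "mpoly_ring n :: 'k mpoly ring" by (rule cring_mpoly_ring)
  let ?x = "\<lambda>i. Poly_Mapping.single i (1::nat)"
  have vars: "(variables n :: 'k mpoly set) = monomial_of ` ?x ` {1..n}"
    by (simp add: variables_def monomial_of_def image_image)
  have max: "max_ideal n = (span_of n (?x ` {1..n}) :: 'k mpoly set)"
    unfolding max_ideal_def vars by (rule Idl_monomials) auto
  have "max_ideal_power n d = (span_of n (exponents n d) :: 'k mpoly set)"
  proof (induction d)
    case 0
    have "(0 :: nat \<Rightarrow>\<^sub>0 nat) \<in> exponents n 0" by (simp add: exponents_def)
    then have "\<exists>a \<in> exponents n 0. \<exists>c. e = a + c" for e
      by (intro bexI[of _ 0] exI[of _ e]) simp_all
    then have "span_of n (exponents n 0) = (carrier (mpoly_ring n) :: 'k mpoly set)"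
      unfolding span_of_def by blast
    then show ?case
      by (simp add: max_ideal_power_def ideals_set_def nat_pow_def)
  next
    case (Suc d)
    let ?A = "span_of n (exponents n d) :: 'k mpoly set"
    let ?M = "span_of n (?x ` {1..n}) :: 'k mpoly set"
    have "max_ideal_power n (Suc d) = ideal_prod (mpoly_ring n) ?A ?M"
      using Suc unfolding max[symmetric] by (simp add: max_ideal_power_def ideals_set_def nat_pow_def)
    also have "\<dots> = span_of n (exponents n (Suc d))"
    proof
      show "ideal_prod (mpoly_ring n) ?A ?M \<subseteq> span_of n (exponents n (Suc d))"
      proof
        fix p assume "p \<in> ideal_prod (mpoly_ring n) ?A ?M"
        then show "p \<in> span_of n (exponents n (Suc d))"
        proof (induction rule: ideal_prod.induct)
          case (prod f g)
          have "\<exists>a \<in> exponents n (Suc d). \<exists>c. e = a + c" if e: "e \<in> Poly_Mapping.keys (f * g)" for e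
          proof -
            obtain v w where vw: "v \<in> Poly_Mapping.keys f" "w \<in> Poly_Mapping.keys g" "e = v + w"
              using e keys_mult[of f g] by blast
            obtain a c where "a \<in> exponents n d" "v = a + c"
              using prod(1) vw(1) unfolding span_of_def by blast
            moreover obtain i c' where "i \<in> {1..n}" "w = ?x i + c'"
              using prod(2) vw(2) unfolding span_of_def by blast
            ultimately have "e = (a + ?x i) + (c + c')" "a + ?x i \<in> exponents n (Suc d)"
              using single_in_exponents vw(3) by (auto simp: ac_simps)
            then show ?thesis by blast
          qed
          then show ?case
            using prod mpoly_ring_mult_closed[of f n g] by (simp add: span_of_def)
        next
          case (sum f g)
          then show ?case
            using additive_subgroup.a_closed[OF ideal.axioms(1)[OF ideal_span_of]] by blast
        qed
      qed
      have ideal: "ideal (ideal_prod (mpoly_ring n) ?A ?M) (mpoly_ring n)"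
        by (intro ideal_prod_is_ideal ideal_span_of)
      have "monomial_of e \<in> ideal_prod (mpoly_ring n) ?A ?M"
        if e: "e \<in> exponents n (Suc d)" for e
      proof -
        obtain a i where a: "a \<in> exponents n d" "i \<in> {1..n}" "e = a + ?x i"
          using exponents_Suc[OF e] by blast
        have "monomial_of a \<in> ?A"
          using a(1) exponents_keys[OF a(1)] unfolding monomial_of_in_span_of
          by (auto intro!: bexI[of _ a] exI[of _ 0])
        moreover have "monomial_of (?x i) \<in> ?M"
          using a(2) unfolding monomial_of_in_span_of by (auto intro!: exI[of _ 0])
        ultimately have "monomial_of a \<otimes>\<^bsub>mpoly_ring n\<^esub> monomial_of (?x i) \<in>
            ideal_prod (mpoly_ring n) ?A ?M"
          by (rule ideal_prod.prod)
        then show ?thesis by (simp add: a(3) monomial_of_def mult_single)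
      qed
      then have "Idl\<^bsub>mpoly_ring n\<^esub> (monomial_of ` exponents n (Suc d)) \<subseteq>
          ideal_prod (mpoly_ring n) ?A ?M"
        by (intro genideal_minimal ideal) blast
      then show "span_of n (exponents n (Suc d)) \<subseteq> ideal_prod (mpoly_ring n) ?A ?M"
        by (simp only: Idl_exponents[OF subset_refl])
    qed
    finally show ?case .
  qed
  then show ?thesis by (simp only: Idl_exponents[OF subset_refl])
qed

section \<open>Translation to exponents and conclusion\<close>

lemma squarefree_monomial_ideal_Idl:
  assumes "E \<subseteq> squarefree_exponents n d"
  shows "squarefree_monomial_ideal n (Idl\<^bsub>mpoly_ring n\<^esub> (monomial_of ` E) :: 'k::field mpoly set)"
  unfolding squarefree_monomial_ideal_def
  by (intro exI[of _ "monomial_of ` E"])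
     (use assms in \<open>auto simp: squarefree_monomials_def squarefree_exponents_def exponents_def\<close>)

lemma squarefree_imp_monomial_ideal: "squarefree_monomial_ideal n I \<Longrightarrow> monomial_ideal n I"
  unfolding squarefree_monomial_ideal_def monomial_ideal_def
    squarefree_monomials_def monomials_def by blast

text \<open>
  For fixed \<open>n\<close> and \<open>d\<close>, the statements about ideals in terms of sets of exponents.
\<close>

lemma squarefree_statement_iff:
  "(\<forall>I :: 'k::field mpoly set.
      squarefree_monomial_ideal n I \<and> has_linear_quotients n I \<and>
      min_gens n I \<subseteq> min_gens n (squarefree_veronese_ideal n d) \<longrightarrow>
      extendable_by_linear_quotients n I (squarefree_veronese_ideal n d)) \<longleftrightarrow>
   (\<forall>E \<subseteq> squarefree_exponents n d. extends {} E \<longrightarrow> extends E (squarefree_exponents n d))"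
    (is "?L \<longleftrightarrow> ?R")
proof
  let ?Q = "squarefree_exponents n d"
  note Q = squarefree_exponents_subset[of n d]
  assume L: ?L
  show ?R
  proof (intro allI impI)
    fix E assume E: "E \<subseteq> ?Q" "extends {} E"
    let ?I = "Idl\<^bsub>mpoly_ring n\<^esub> (monomial_of ` E) :: 'k mpoly set"
    have En: "E \<subseteq> exponents n d" using E(1) Q by blast
    have "min_gens n ?I \<subseteq> min_gens n (squarefree_veronese_ideal n d)"
      unfolding squarefree_veronese_ideal_eq min_gens_Idl[OF En] min_gens_Idl[OF Q]
      using E(1) by blast
    then have "extendable_by_linear_quotients n ?I (squarefree_veronese_ideal n d)"
      using L squarefree_monomial_ideal_Idl[OF E(1)] has_linear_quotients_iff_extends[OF En] E(2)
      by blast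
    then show "extends E ?Q"
      unfolding squarefree_veronese_ideal_eq extendable_iff_extends[OF E(1) Q] .
  qed
next
  let ?Q = "squarefree_exponents n d"
  note Q = squarefree_exponents_subset[of n d]
  assume R: ?R
  show ?L
  proof (intro allI impI)
    fix I :: "'k mpoly set"
    assume I: "squarefree_monomial_ideal n I \<and> has_linear_quotients n I \<and>
      min_gens n I \<subseteq> min_gens n (squarefree_veronese_ideal n d)"
    then have "min_gens n I \<subseteq> monomial_of ` ?Q"
      unfolding squarefree_veronese_ideal_eq min_gens_Idl[OF Q] by blast
    then obtain E where E: "E \<subseteq> ?Q" and eq: "I = Idl\<^bsub>mpoly_ring n\<^esub> (monomial_of ` E)"
      using I squarefree_imp_monomial_ideal monomial_ideal_with_min_gens_subset by metis
    have En: "E \<subseteq> exponents n d" using E Q by blast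
    have "extends {} E" using I unfolding eq has_linear_quotients_iff_extends[OF En] by blast
    then show "extendable_by_linear_quotients n I (squarefree_veronese_ideal n d)"
      unfolding eq squarefree_veronese_ideal_eq extendable_iff_extends[OF E Q] using R E by blast
  qed
qed

lemma monomial_statement_iff:
  "(\<forall>I :: 'k::field mpoly set.
      monomial_ideal n I \<and> has_linear_quotients n I \<and>
      min_gens n I \<subseteq> min_gens n (max_ideal_power n d) \<longrightarrow>
      extendable_by_linear_quotients n I (max_ideal_power n d)) \<longleftrightarrow>
   (\<forall>E \<subseteq> exponents n d. extends {} E \<longrightarrow> extends E (exponents n d))"
    (is "?L \<longleftrightarrow> ?R")
proof
  note M = subset_refl[of "exponents n d"]
  assume L: ?L
  show ?R
  proof (intro allI impI)
    fix E assume E: "E \<subseteq> exponents n d" "extends {} E"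
    let ?I = "Idl\<^bsub>mpoly_ring n\<^esub> (monomial_of ` E) :: 'k mpoly set"
    have "min_gens n ?I \<subseteq> min_gens n (max_ideal_power n d)"
      unfolding max_ideal_power_eq min_gens_Idl[OF E(1)] min_gens_Idl[OF M] using E(1) by blast
    then have "extendable_by_linear_quotients n ?I (max_ideal_power n d)"
      using L monomial_ideal_Idl[OF E(1)] has_linear_quotients_iff_extends[OF E(1)] E(2) by blast
    then show "extends E (exponents n d)"
      unfolding max_ideal_power_eq extendable_iff_extends[OF E(1) M] .
  qed
next
  note M = subset_refl[of "exponents n d"]
  assume R: ?R
  show ?L
  proof (intro allI impI)
    fix I :: "'k mpoly set"
    assume I: "monomial_ideal n I \<and> has_linear_quotients n I \<and>
      min_gens n I \<subseteq> min_gens n (max_ideal_power n d)"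
    then have "min_gens n I \<subseteq> monomial_of ` exponents n d"
      unfolding max_ideal_power_eq min_gens_Idl[OF M] by blast
    then obtain E where E: "E \<subseteq> exponents n d" and eq: "I = Idl\<^bsub>mpoly_ring n\<^esub> (monomial_of ` E)"
      using I monomial_ideal_with_min_gens_subset by metis
    have "extends {} E" using I unfolding eq has_linear_quotients_iff_extends[OF E] by blast
    then show "extendable_by_linear_quotients n I (max_ideal_power n d)"
      unfolding eq max_ideal_power_eq extendable_iff_extends[OF E M] using R E by blast
  qed
qed

theorem proposition3p3:
  shows
    "(\<forall>n d :: nat. 1 \<le> d \<and> d \<le> n \<longrightarrow>
       (\<forall>I :: 'k::field mpoly set.
          squarefree_monomial_ideal n I \<and> has_linear_quotients n I \<and>
          min_gens n I \<subseteq> min_gens n (squarefree_veronese_ideal n d) \<longrightarrow>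
          extendable_by_linear_quotients n I (squarefree_veronese_ideal n d)))
     \<longleftrightarrow>
     (\<forall>n d :: nat. 1 \<le> n \<and> 1 \<le> d \<longrightarrow>
       (\<forall>I :: 'k mpoly set.
          monomial_ideal n I \<and> has_linear_quotients n I \<and>
          min_gens n I \<subseteq> min_gens n (max_ideal_power n d) \<longrightarrow>
          extendable_by_linear_quotients n I (max_ideal_power n d)))"
  unfolding squarefree_statement_iff monomial_statement_iff
proof (intro iffI allI impI)
  fix n d :: nat and E
  assume simon: "\<forall>n d. 1 \<le> d \<and> d \<le> n \<longrightarrow>
      (\<forall>E \<subseteq> squarefree_exponents n d. extends {} E \<longrightarrow> extends E (squarefree_exponents n d))"
    and "1 \<le> n \<and> 1 \<le> d" and E: "E \<subseteq> exponents n d" "extends {} E"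
  then have "1 \<le> d" "d \<le> n * d" by auto
  with simon have "extends F (squarefree_exponents (n * d) d)"
    if "F \<subseteq> squarefree_exponents (n * d) d" "extends {} F" for F
    using that by blast
  from extends_exponents[OF \<open>1 \<le> d\<close> this E] show "extends E (exponents n d)" .
next
  fix n d :: nat and E
  assume monomial_simon: "\<forall>n d. 1 \<le> n \<and> 1 \<le> d \<longrightarrow>
      (\<forall>E \<subseteq> exponents n d. extends {} E \<longrightarrow> extends E (exponents n d))"
    and nd: "1 \<le> d \<and> d \<le> n" and E: "E \<subseteq> squarefree_exponents n d" "extends {} E"
  have "E \<subseteq> exponents n d" using E(1) squarefree_exponents_subset by blast
  then have "extends E (exponents n d)" using monomial_simon nd E(2) by auto
  then have "extends (E \<inter> squarefree_exponents n d)
      (exponents n d \<inter> squarefree_exponents n d)"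
    by (rule extends_squarefree)
  moreover have "E \<inter> squarefree_exponents n d = E" using E(1) by blast
  moreover have "exponents n d \<inter> squarefree_exponents n d = squarefree_exponents n d"
    using squarefree_exponents_subset by blast
  ultimately show "extends E (squarefree_exponents n d)" by simp
qed

end
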